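(* Let $n\ge 1$. (i) There exists, for each $S\in Sp(2n,\mathbb{R})$, a map $$\varphi_S:\ CH_n\longrightarrow PH_n,\qquad \theta_{CH_n}({\bf d},{\bf v})\ \longmapsto\ \theta_{PH_n}\left(S^{T}\begin{bmatrix}D&0\\0&D\end{bmatrix}S,\ S^{-1}{\bf v}\right),\qquad D=\mathrm{diag}({\bf d}),$$ such that the controllable Hamiltonian system $\theta_{CH_n}({\bf d},{\bf v})\in CH_n$ and its port-Hamiltonian image $\varphi_S(\theta_{CH_n}({\bf d},{\bf v}))\in PH_n$ are linked by a linear system morphism $f_S^{({\bf d},{\bf v})}:\mathbb{R}^{2n}\to\mathbb{R}^{2n}$ (from the state space of the former to the state space of the latter). (ii) Given a port-Hamiltonian system $\theta_{PH_n}(Q,B)\in PH_n$, there exists an explicit linear system morphism $f^{(Q,B)}:\mathbb{R}^{2n}\to\mathbb{R}^{2n}$ between the state space of $\theta_{PH_n}(Q,B)$ and that of an observable Hamiltonian system $\theta_{OH_n}({\bf d},{\bf v})\in OH_n$ (from the former to the latter), where $({\bf d},{\bf v})\in\Theta_{OH_n}$ is determined by the Williamson normal form decomposition of $Q$ determined by $S\in Sp(2n,\mathbb{R})$, that is, $Q=S^{T}\begin{bmatrix}D&0\\0&D\end{bmatrix}S$, $D=\mathrm{diag}({\bf d})$ and ${\bf v}=S\cdot B$.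
   Context: $\mathbb{M}_{k}$ is the space of real $k\times k$ matrices, $\mathbb{J}=\mathbb{J}_n=\begin{bmatrix}0&\mathbb{I}_n\\-\mathbb{I}_n&0\end{bmatrix}$, and $Sp(2n,\mathbb{R})=\{S\in\mathbb{M}_{2n}: S^T\mathbb{J}S=\mathbb{J}\}$. By Williamson's theorem, every symmetric positive-definite $Q\in\mathbb{M}_{2n}$ can be written as $Q=S^{T}\begin{bmatrix}D&0\\0&D\end{bmatrix}S$ with $S\in Sp(2n,\mathbb{R})$ and $D=\mathrm{diag}({\bf d})$, ${\bf d}=(d_1,\dots,d_n)^T$, all $d_i>0$. State-space systems and morphisms. A state-space system $(\mathcal{Z},F,h)$ is $\dot{\bf z}=F({\bf z},u)$, $y=h({\bf z})$, with input $u$ and output $y$ (here both real-valued). A system morphism from $(\mathcal{Z}_1,F_1,h_1)$ to $(\mathcal{Z}_2,F_2,h_2)$ is a map $f:\mathcal{Z}_1\to\mathcal{Z}_2$ with $f(F_1({\bf z}_1,u))=F_2(f({\bf z}_1),u)$ and $h_1({\bf z}_1)=h_2(f({\bf z}_1))$ for all ${\bf z}_1\in\mathcal{Z}_1$ and all $u$. Port-Hamiltonian systems. $\Theta_{PH_n}=\{(Q,B): Q\in\mathbb{M}_{2n}\text{ symmetric positive-definite},\ B\in\mathbb{R}^{2n}\}$. For $(Q,B)\in\Theta_{PH_n}$, $\theta_{PH_n}(Q,B)$ is the system on $\mathbb{R}^{2n}$: $\dot{\bf z}=\mathbb{J}Q{\bf z}+Bu$, $y=B^TQ{\bf z}$.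 $PH_n$ is the set of all these systems. Controllable/observable Hamiltonian representations. $\Theta_{CH_n}=\Theta_{OH_n}=\{({\bf d},{\bf v}): {\bf d}=(d_1,\dots,d_n)^T\in\mathbb{R}^n,\ d_i>0,\ {\bf v}\in\mathbb{R}^{2n}\}$. For $({\bf d},{\bf v})$ in this set: - the real numbers $a_0,\dots,a_{2n-1}$ are defined by $\lambda^{2n}+\sum_{i=0}^{2n-1}a_i\lambda^i=(\lambda^2+d_1^2)\cdots(\lambda^2+d_n^2)$, and $$g_1^{ctr}({\bf d})=\begin{bmatrix}0&1&0&\cdots&0\\0&0&1&\cdots&0\\\vdots&\vdots&\ddots&\ddots&\vdots\\0&0&0&\cdots&1\\-a_0&-a_1&-a_2&\cdots&-a_{2n-1}\end{bmatrix}\in\mathbb{M}_{2n};$$ - $g_2^{ctr}({\bf d},{\bf v})=\begin{bmatrix}0&c_{2n-1}&0&c_{2n-3}&\cdots&0&c_1\end{bmatrix}$ (a $1\times 2n$ row), where for $k=0,\dots,n-1$ $$c_{2k+1}={\bf v}^T\begin{bmatrix}F_k&0\\0&F_k\end{bmatrix}{\bf v},\quad F_k=\mathrm{diag}(f_1,\dots,f_n),\quad f_l=d_l\cdot\sum_{\substack{1\le j_1<\dots<j_k\le n\\ j_1,\dots,j_k\ne l}}(d_{j_1}d_{j_2}\cdots d_{j_k})^2$$ (for $k=0$ the sum is $1$, so $f_l=d_l$). $\theta_{CH_n}({\bf d},{\bf v})$ is the system on $\mathbb{R}^{2n}$: $\dot{\bf s}=g_1^{ctr}({\bf d}){\bf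 s}+(0,\dots,0,1)^Tu$, $y=g_2^{ctr}({\bf d},{\bf v}){\bf s}$; $CH_n$ is the set of all these systems. With $g_1^{obs}=(g_1^{ctr})^T$ and $g_2^{obs}=(g_2^{ctr})^T$, $\theta_{OH_n}({\bf d},{\bf v})$ is the system on $\mathbb{R}^{2n}$: $\dot{\bf s}=g_1^{obs}({\bf d}){\bf s}+g_2^{obs}({\bf d},{\bf v})u$, $y=(0,\dots,0,1){\bf s}$; $OH_n$ is the set of all these systems.
   Formalization: In (i) the formula does not define a map on the set CH_n (n=1: v=(1,0) and (0,1) give the same controllable system but different images), so φ_S is taken on the parameters (d,v); a map CH_n→PH_n is also given that uses the formula at some parameter representing each system. *)

theory Defs
  imports
    "Jordan_Normal_Form.VS_Connect"
    "Jordan_Normal_Form.Gauss_Jordan_Elimination"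
    "HOL-Library.FuncSet"
begin

section \<open>State-space systems and morphisms\<close>

text \<open>A state-space system \<open>(Z, F, h)\<close> with real input and output.  The concrete systems
  below are extensional outside \<open>Z\<close>, so that HOL equality is equality of systems.\<close>

type_synonym 'z state_space_system = "'z set \<times> ('z \<Rightarrow> real \<Rightarrow> 'z) \<times> ('z \<Rightarrow> real)"

fun system_morphism ::
  "'a state_space_system \<Rightarrow> 'b state_space_system \<Rightarrow> ('a \<Rightarrow> 'b) \<Rightarrow> bool" where
  "system_morphism (Z\<^sub>1, F\<^sub>1, h\<^sub>1) (Z\<^sub>2, F\<^sub>2, h\<^sub>2) f \<longleftrightarrow>
     f \<in> Z\<^sub>1 \<rightarrow> Z\<^sub>2 \<and>
     (\<forall>z\<in>Z\<^sub>1. (\<forall>u. f (F\<^sub>1 z u) = F\<^sub>2 (f z) u) \<and> h\<^sub>1 z = h\<^sub>2 (f z))"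

abbreviation linear_map_on_vecs :: "nat \<Rightarrow> (real vec \<Rightarrow> real vec) \<Rightarrow> bool" where
  "linear_map_on_vecs m f \<equiv>
     linear_map class_ring (module_vec TYPE(real) m) (module_vec TYPE(real) m) f"

text \<open>The single-input single-output linear system
  \<open>z' = A z + u b\<close>, \<open>y = h z\<close> on \<open>\<real>\<^sup>m\<close>; a row vector such as
  \<open>B\<^sup>T Q\<close> enters only through the scalar product.\<close>

definition linear_system ::
  "nat \<Rightarrow> real mat \<Rightarrow> real vec \<Rightarrow> (real vec \<Rightarrow> real) \<Rightarrow> real vec state_space_system" where
  "linear_system m A b h =
     (carrier_vec m,
      \<lambda>z\<in>carrier_vec m. \<lambda>u. A *\<^sub>v z + u \<cdot>\<^sub>v b,
      \<lambda>z\<in>carrier_vec m. h z)"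

section \<open>Symplectic matrices and the Williamson normal form\<close>

definition J_mat :: "nat \<Rightarrow> real mat" where
  "J_mat n = four_block_mat (0\<^sub>m n n) (1\<^sub>m n) (- 1\<^sub>m n) (0\<^sub>m n n)"

definition Sp :: "nat \<Rightarrow> real mat set" where
  "Sp n = {S \<in> carrier_mat (2*n) (2*n). S\<^sup>T * J_mat n * S = J_mat n}"

definition block_dbl :: "nat \<Rightarrow> (nat \<Rightarrow> real) \<Rightarrow> real mat" where
  "block_dbl n f = four_block_mat (mat_diag n f) (0\<^sub>m n n) (0\<^sub>m n n) (mat_diag n f)"

definition williamson_mat :: "nat \<Rightarrow> real mat \<Rightarrow> real vec \<Rightarrow> real mat" where
  "williamson_mat n S d = S\<^sup>T * block_dbl n (\<lambda>i. d $ i) * S"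

abbreviation matinv :: "real mat \<Rightarrow> real mat" where
  "matinv S \<equiv> the (mat_inverse S)"

definition sym_pos_def :: "nat \<Rightarrow> real mat \<Rightarrow> bool" where
  "sym_pos_def m Q \<longleftrightarrow> Q \<in> carrier_mat m m \<and> Q\<^sup>T = Q \<and>
     (\<forall>x\<in>carrier_vec m. x \<noteq> 0\<^sub>v m \<longrightarrow> 0 < x \<bullet> (Q *\<^sub>v x))"

section \<open>Port-Hamiltonian systems\<close>

definition Theta_PH :: "nat \<Rightarrow> (real mat \<times> real vec) set" where
  "Theta_PH n = {(Q, B). sym_pos_def (2*n) Q \<and> B \<in> carrier_vec (2*n)}"

fun theta_PH :: "nat \<Rightarrow> real mat \<times> real vec \<Rightarrow> real vec state_space_system" where
  "theta_PH n (Q, B) = linear_system (2*n) (J_mat n * Q) B (\<lambda>z. B \<bullet> (Q *\<^sub>v z))"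

definition PH :: "nat \<Rightarrow> real vec state_space_system set" where
  "PH n = theta_PH n ` Theta_PH n"

section \<open>Controllable and observable Hamiltonian systems\<close>

definition Theta_CH :: "nat \<Rightarrow> (real vec \<times> real vec) set" where
  "Theta_CH n = {(d, v). d \<in> carrier_vec n \<and> (\<forall>i<n. 0 < d $ i) \<and> v \<in> carrier_vec (2*n)}"

definition Theta_OH :: "nat \<Rightarrow> (real vec \<times> real vec) set" where
  "Theta_OH n = Theta_CH n"

text \<open>The product has degree \<open>2n\<close> and leading coefficient 1; the numbers
  \<open>a\<^sub>0, \<dots>, a\<^bsub>2n-1\<^esub>\<close> are its remaining coefficients.\<close>

definition a_coeff :: "nat \<Rightarrow> real vec \<Rightarrow> nat \<Rightarrow> real" where
  "a_coeff n d i = coeff (\<Prod>j<n. [:(d $ j)\<^sup>2, 0, 1:]) i"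

definition g1_ctr :: "nat \<Rightarrow> real vec \<Rightarrow> real mat" where
  "g1_ctr n d = mat (2*n) (2*n) (\<lambda>(i, j).
     if i = 2*n - 1 then - a_coeff n d j else if j = Suc i then 1 else 0)"

definition f_coeff :: "nat \<Rightarrow> real vec \<Rightarrow> nat \<Rightarrow> nat \<Rightarrow> real" where
  "f_coeff n d k l =
     d $ l * (\<Sum>J | J \<subseteq> {..<n} - {l} \<and> card J = k. (\<Prod>j\<in>J. d $ j)\<^sup>2)"

text \<open>\<open>c_odd n d v k\<close> is the number \<open>c\<^bsub>2k+1\<^esub>\<close>.\<close>

definition c_odd :: "nat \<Rightarrow> real vec \<Rightarrow> real vec \<Rightarrow> nat \<Rightarrow> real" where
  "c_odd n d v k = v \<bullet> (block_dbl n (f_coeff n d k) *\<^sub>v v)"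

text \<open>The row \<open>(0, c\<^bsub>2n-1\<^esub>, 0, c\<^bsub>2n-3\<^esub>, \<dots>, 0, c\<^sub>1)\<close>: counting positions from 0, the
  entry at an odd position \<open>j\<close> is \<open>c\<^bsub>2n-j\<^esub>\<close>.\<close>

definition g2_ctr :: "nat \<Rightarrow> real vec \<Rightarrow> real vec \<Rightarrow> real vec" where
  "g2_ctr n d v = vec (2*n) (\<lambda>j. if odd j then c_odd n d v ((2*n - j - 1) div 2) else 0)"

definition g1_obs :: "nat \<Rightarrow> real vec \<Rightarrow> real mat" where
  "g1_obs n d = (g1_ctr n d)\<^sup>T"

text \<open>The column \<open>g2_obs\<close> is the transpose of the row \<open>g2_ctr\<close>, hence the same vector here.\<close>

definition g2_obs :: "nat \<Rightarrow> real vec \<Rightarrow> real vec \<Rightarrow> real vec" where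
  "g2_obs n d v = g2_ctr n d v"

fun theta_CH :: "nat \<Rightarrow> real vec \<times> real vec \<Rightarrow> real vec state_space_system" where
  "theta_CH n (d, v) =
     linear_system (2*n) (g1_ctr n d) (unit_vec (2*n) (2*n - 1)) (\<lambda>s. g2_ctr n d v \<bullet> s)"

fun theta_OH :: "nat \<Rightarrow> real vec \<times> real vec \<Rightarrow> real vec state_space_system" where
  "theta_OH n (d, v) =
     linear_system (2*n) (g1_obs n d) (g2_obs n d v) (\<lambda>s. unit_vec (2*n) (2*n - 1) \<bullet> s)"

definition CH :: "nat \<Rightarrow> real vec state_space_system set" where
  "CH n = theta_CH n ` Theta_CH n"

definition OH :: "nat \<Rightarrow> real vec state_space_system set" where
  "OH n = theta_OH n ` Theta_OH n"

end

theory Submission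
  imports
    Defs
    "HOL-Analysis.Function_Topology"
    "Jordan_Normal_Form.Char_Poly"
begin

text \<open>
  Put \<open>A = J (D \<oplus> D)\<close>; on the plane of the \<open>l\<close>-th conjugate pair it is \<open>d\<^sub>l\<close> times a rotation.  For
  \<open>Q = S\<^sup>T (D \<oplus> D) S\<close> with \<open>S\<close> symplectic, \<open>J Q = S\<^bsup>-1\<^esup> A S\<close>, so everything reduces to \<open>A\<close>.  There the
  matrix \<open>W\<close> of the controller canonical form satisfies \<open>W g\<^sub>1 = A W\<close> and has an explicit expression,
  because the quotient of the characteristic polynomial by \<open>\<lambda>\<^sup>2 + d\<^sub>l\<^sup>2\<close> has the elementary symmetric
  functions of the other \<open>d\<^sub>j\<^sup>2\<close> as coefficients; these are the sums in \<open>f_coeff\<close>.  Part (i) uses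
  \<open>S\<^bsup>-1\<^esup> W\<close>, part (ii) the transpose of \<open>W\<close> for \<open>-A\<close>, composed with \<open>S\<close>.

  The map in (ii) must not depend on the decomposition of \<open>Q\<close>.  The characteristic polynomial of
  \<open>J Q\<close> determines \<open>g\<^sub>1\<close>, and an intertwiner with the observer form is determined by its last row,
  which is \<open>B\<^sup>T Q\<close>.

  Williamson's theorem follows by a symplectic Gram-Schmidt process: in the symplectic complement of
  the pairs found so far, maximize \<open>\<omega>(x, y)\<close> over \<open>Q\<close>-unit vectors.  The first order conditions say
  that \<open>\<omega>(x, z) = \<mu> Q(y, z)\<close> and \<open>\<omega>(z, y) = \<mu> Q(x, z)\<close> on the complement, so \<open>x / \<surd>\<mu>\<close>, \<open>y / \<surd>\<mu>\<close>
  is the next pair, with symplectic eigenvalue \<open>1 / \<mu>\<close>.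
\<close>

section \<open>Symplectic Gram-Schmidt process\<close>

text \<open>Vectors are functions whose values beyond \<open>m\<close> are ignored; on this type the
  product topology supplies the compactness used below.\<close>

definition bil :: "nat \<Rightarrow> (nat \<Rightarrow> nat \<Rightarrow> real) \<Rightarrow> (nat \<Rightarrow> real) \<Rightarrow> (nat \<Rightarrow> real) \<Rightarrow> real" where
  "bil m M x y = (\<Sum>i<m. \<Sum>j<m. x i * M i j * y j)"

lemma bil_left: "bil m M (\<lambda>i. a * x i + b * y i) z = a * bil m M x z + b * bil m M y z"
  unfolding bil_def sum_distrib_left sum.distrib[symmetric]
  by (intro sum.cong refl) (simp add: algebra_simps)

lemma bil_right: "bil m M z (\<lambda>i. a * x i + b * y i) = a * bil m M z x + b * bil m M z y"
  unfolding bil_def sum_distrib_left sum.distrib[symmetric]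
  by (intro sum.cong refl) (simp add: algebra_simps)

lemma bil_scale_left: "bil m M (\<lambda>i. a * x i) z = a * bil m M x z"
  using bil_left[of m M a x 0 x z] by simp

lemma bil_scale_right: "bil m M z (\<lambda>i. a * x i) = a * bil m M z x"
  using bil_right[of m M z a x 0 x] by simp

lemma bil_diff_left: "bil m M (\<lambda>i. x i - y i) z = bil m M x z - bil m M y z"
  using bil_left[of m M 1 x "-1" y z] by simp

lemma bil_diff_right: "bil m M z (\<lambda>i. x i - y i) = bil m M z x - bil m M z y"
  using bil_right[of m M z 1 x "-1" y] by simp

lemma bil_sum_left: "bil m M (\<lambda>i. \<Sum>k\<in>K. x k i) z = (\<Sum>k\<in>K. bil m M (x k) z)"
proof -
  have "bil m M (\<lambda>i. \<Sum>k\<in>K. x k i) z = (\<Sum>i<m. \<Sum>j<m. \<Sum>k\<in>K. x k i * M i j * z j)"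
    by (simp add: bil_def sum_distrib_right)
  also have "\<dots> = (\<Sum>i<m. \<Sum>k\<in>K. \<Sum>j<m. x k i * M i j * z j)"
    by (intro sum.cong refl) (rule sum.swap)
  also have "\<dots> = (\<Sum>k\<in>K. \<Sum>i<m. \<Sum>j<m. x k i * M i j * z j)"
    by (rule sum.swap)
  finally show ?thesis by (simp add: bil_def)
qed

lemma bil_swap:
  assumes "\<And>i j. i < m \<Longrightarrow> j < m \<Longrightarrow> M j i = s * M i j"
  shows "bil m M y x = s * bil m M x y"
proof -
  have "bil m M y x = (\<Sum>j<m. \<Sum>i<m. x i * M j i * y j)"
    by (simp add: bil_def mult.commute mult.left_commute)
  also have "\<dots> = (\<Sum>i<m. \<Sum>j<m. x i * M j i * y j)"
    by (rule sum.swap)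
  also have "\<dots> = (\<Sum>i<m. \<Sum>j<m. s * (x i * M i j * y j))"
  proof (intro sum.cong refl)
    fix i j assume "i \<in> {..<m}" "j \<in> {..<m}"
    then show "x i * M j i * y j = s * (x i * M i j * y j)"
      using assms[of i j] by simp
  qed
  finally show ?thesis by (simp add: bil_def sum_distrib_left)
qed

lemma bil_cong:
  assumes "\<And>i. i < m \<Longrightarrow> x i = x' i" "\<And>i. i < m \<Longrightarrow> y i = y' i"
  shows "bil m M x y = bil m M x' y'"
  by (simp add: bil_def assms)

lemma bil_nonzero:
  assumes "bil m M x y \<noteq> 0"
  shows "\<exists>i<m. x i \<noteq> 0" "\<exists>i<m. y i \<noteq> 0"
  by (rule ccontr, use assms in \<open>simp add: bil_def\<close>)+

text \<open>The trace computation for the symplectic projection below rests on this expansion of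
  \<open>x\<close> in unit vectors.\<close>

lemma bil_unit_sum: "(\<Sum>j<m. x j * bil m M (\<lambda>i. of_bool (i = j)) w) = bil m M x w"
proof -
  have "bil m M (\<lambda>i. of_bool (i = j)) w = (\<Sum>l<m. M j l * w l)" if "j < m" for j
  proof -
    have "bil m M (\<lambda>i. of_bool (i = j)) w = (\<Sum>i<m. if i = j then (\<Sum>l<m. M j l * w l) else 0)"
      unfolding bil_def by (intro sum.cong refl) auto
    also have "\<dots> = (\<Sum>l<m. M j l * w l)" using that by simp
    finally show ?thesis .
  qed
  then show ?thesis by (simp add: bil_def sum_distrib_left mult.assoc)
qed

lemma continuous_on_bil [continuous_intros]:
  fixes f g :: "'a::topological_space \<Rightarrow> nat \<Rightarrow> real"
  assumes "continuous_on A f" "continuous_on A g"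
  shows "continuous_on A (\<lambda>p. bil m M (f p) (g p))"
proof -
  have "continuous_on A (\<lambda>p. f p i)" "continuous_on A (\<lambda>p. g p i)" for i
    using assms by (auto intro: continuous_on_product_then_coordinatewise)
  then show ?thesis
    unfolding bil_def by (intro continuous_intros)
qed

text \<open>Forcing the values beyond \<open>m\<close> to vanish puts the set into a product of
  compact intervals, compact by Tychonoff; the remaining conditions are closed.\<close>

lemma compact_unit_sphere_fun:
  "compact {x :: nat \<Rightarrow> real. (\<forall>i\<ge>m. x i = 0) \<and> (\<Sum>i<m. (x i)\<^sup>2) = 1 \<and> (\<forall>w\<in>C. bil m M x w = 0)}"
    (is "compact ?K")
proof -
  define box where "box = (\<Pi>\<^sub>E i\<in>UNIV. if i < m then {-1..1} else {0::real})"
  have "compactin (product_topology (\<lambda>i. euclidean) UNIV) box"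
    unfolding box_def compactin_PiE by (auto simp: compactin_euclidean_iff)
  then have box: "compact box"
    by (simp add: euclidean_product_topology compactin_euclidean_iff)
  have "closed {x :: nat \<Rightarrow> real. (\<Sum>i<m. (x i)\<^sup>2) = 1}"
    by (intro closed_Collect_eq continuous_intros continuous_on_product_coordinates)
  moreover have "closed {x. \<forall>w\<in>C. bil m M x w = 0}"
    unfolding Collect_ball_eq
    by (intro closed_INT ballI closed_Collect_eq continuous_intros)
  ultimately have "compact (box \<inter> ({x. (\<Sum>i<m. (x i)\<^sup>2) = 1} \<inter> {x. \<forall>w\<in>C. bil m M x w = 0}))"
    by (intro compact_Int_closed box closed_Int)
  also have "box \<inter> ({x. (\<Sum>i<m. (x i)\<^sup>2) = 1} \<inter> {x. \<forall>w\<in>C. bil m M x w = 0}) = ?K"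
  proof -
    have "\<bar>x i\<bar> \<le> 1" if "(\<Sum>i<m. (x i)\<^sup>2) = 1" "i < m" for x :: "nat \<Rightarrow> real" and i
    proof -
      have "(x i)\<^sup>2 \<le> (\<Sum>i<m. (x i)\<^sup>2)" using that by (intro member_le_sum) auto
      then show ?thesis using that by (simp add: abs_square_le_1)
    qed
    moreover have "x \<in> box \<longleftrightarrow> (\<forall>i<m. \<bar>x i\<bar> \<le> 1) \<and> (\<forall>i\<ge>m. x i = 0)" for x
      unfolding box_def PiE_UNIV_domain Pi_iff by (auto simp: abs_le_iff minus_le_iff not_less[symmetric])
    ultimately show ?thesis by blast
  qed
  finally show ?thesis .
qed

text \<open>At \<open>t = 0\<close> both sides agree and the right side has derivative 0, so a
  nonzero slope \<open>a\<close> on the left would break the bound nearby.\<close>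

lemma vanishing_first_order_term:
  fixes a c \<mu> :: real
  assumes "0 < \<mu>" "0 \<le> c" and bound: "\<And>t. \<mu> + t * a \<le> \<mu> * sqrt (1 + t\<^sup>2 * c)"
  shows "a = 0"
proof (rule ccontr)
  assume "a \<noteq> 0"
  \<comment> \<open>The test point is \<open>t = a * s\<close>. After squaring, the right side gains
    \<open>(\<mu> * s * a\<^sup>2) * (\<mu> * c * s)\<close>, which for this \<open>s\<close> is
    below \<open>\<mu> * s * a\<^sup>2\<close>, while the left side gains at least
    \<open>2 * \<mu> * s * a\<^sup>2\<close>.\<close>
  define s where "s = 1 / (\<mu> * c + 1)"
  have s: "0 < s" "\<mu> * c * s < 1"
    using assms by (auto simp: s_def field_simps add_pos_nonneg add_nonneg_pos)
  have "(\<mu> + (a * s) * a)\<^sup>2 \<le> (\<mu> * sqrt (1 + (a * s)\<^sup>2 * c))\<^sup>2"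
    using assms s by (intro power_mono bound) (auto simp: mult.assoc mult.left_commute[of a])
  also have "\<dots> = \<mu>\<^sup>2 * (1 + (a * s)\<^sup>2 * c)"
    using assms by (simp add: power_mult_distrib)
  finally have "2 * \<mu> * s * a\<^sup>2 + s\<^sup>2 * (a\<^sup>2)\<^sup>2 \<le> (\<mu> * s * a\<^sup>2) * (\<mu> * c * s)"
    by (simp add: power2_eq_square algebra_simps)
  moreover have "(\<mu> * s * a\<^sup>2) * (\<mu> * c * s) \<le> (\<mu> * s * a\<^sup>2) * 1"
    using assms s by (intro mult_left_mono) auto
  moreover have "0 < \<mu> * s * a\<^sup>2" "0 \<le> s\<^sup>2 * (a\<^sup>2)\<^sup>2"
    using assms s \<open>a \<noteq> 0\<close> by auto
  ultimately show False by linarith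
qed

section \<open>Maximizing the symplectic form and extending families of pairs\<close>

locale sympl_pos =
  fixes m :: nat and Q W :: "nat \<Rightarrow> nat \<Rightarrow> real"
  assumes Q_sym: "\<And>i j. i < m \<Longrightarrow> j < m \<Longrightarrow> Q j i = Q i j"
    and Q_pos: "\<And>x i. i < m \<Longrightarrow> x i \<noteq> 0 \<Longrightarrow> 0 < bil m Q x x"
    and W_alt: "\<And>i j. i < m \<Longrightarrow> j < m \<Longrightarrow> W j i = - W i j"
    and W_nondeg: "\<And>x i. i < m \<Longrightarrow> x i \<noteq> 0 \<Longrightarrow> \<exists>y. bil m W x y \<noteq> 0"
begin

abbreviation "q \<equiv> bil m Q"
abbreviation "\<omega> \<equiv> bil m W"

lemma q_sym: "q y x = q x y"
proof -
  have "q y x = 1 * q x y" by (rule bil_swap, subst Q_sym) auto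
  then show ?thesis by simp
qed

lemma \<omega>_alt: "\<omega> y x = - \<omega> x y"
proof -
  have "\<omega> y x = - 1 * \<omega> x y" by (rule bil_swap, subst W_alt) auto
  then show ?thesis by simp
qed

lemma q_nonneg: "0 \<le> q x x"
proof (cases "\<exists>i<m. x i \<noteq> 0")
  case True
  then show ?thesis using Q_pos by (meson less_imp_le)
next
  case False
  then show ?thesis by (simp add: bil_def)
qed

text \<open>The quotient of \<open>\<omega> a b\<close> by the \<open>q\<close>-norms is homogeneous of degree 0, so its maximum over a
  product of Euclidean unit spheres bounds it everywhere.\<close>

lemma normalized_maximizer:
  assumes "\<forall>w\<in>C. \<omega> x0 w = 0" "\<forall>w\<in>C. \<omega> y0 w = 0" "0 < \<omega> x0 y0"
  obtains \<mu> x y where "0 < \<mu>" "\<forall>w\<in>C. \<omega> x w = 0" "\<forall>w\<in>C. \<omega> y w = 0"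
    "q x x = 1" "q y y = 1" "\<omega> x y = \<mu>"
    "\<And>a b. \<forall>w\<in>C. \<omega> a w = 0 \<Longrightarrow> \<forall>w\<in>C. \<omega> b w = 0 \<Longrightarrow> \<omega> a b \<le> \<mu> * (sqrt (q a a) * sqrt (q b b))"
proof -
  define K where "K = {x. (\<forall>i\<ge>m. x i = 0) \<and> (\<Sum>i<m. (x i)\<^sup>2) = 1 \<and> (\<forall>w\<in>C. \<omega> x w = 0)}"
  have K: "compact K" unfolding K_def by (rule compact_unit_sphere_fun)
  have K_pos: "0 < q x x" if "x \<in> K" for x
  proof -
    have "\<exists>i<m. x i \<noteq> 0"
    proof (rule ccontr)
      assume "\<not> ?thesis"
      then have "(\<Sum>i<m. (x i)\<^sup>2) = 0" by auto
      then show False using that by (simp add: K_def)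
    qed
    then show ?thesis using Q_pos by blast
  qed
  \<comment> \<open>Cutting \<open>x\<close> off beyond \<open>m\<close> and dividing by its
    Euclidean norm keeps the linear constraints.\<close>
  have normalize: "\<exists>c>0. (\<lambda>i. c * (if i < m then x i else 0)) \<in> K"
    if "\<forall>w\<in>C. \<omega> x w = 0" "\<exists>i<m. x i \<noteq> 0" for x
  proof -
    have pos: "0 < (\<Sum>i<m. (x i)\<^sup>2)" (is "0 < ?s")
      using that(2) by (auto intro: sum_pos2)
    have "(\<Sum>i<m. (1 / sqrt ?s * (if i < m then x i else 0))\<^sup>2) = (\<Sum>i<m. (x i)\<^sup>2 / ?s)"
      using pos by (intro sum.cong) (auto simp: power_mult_distrib power_divide sum_nonneg)
    also have "\<dots> = 1" using pos by (simp flip: sum_divide_distrib)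
    finally have "(\<Sum>i<m. (1 / sqrt ?s * (if i < m then x i else 0))\<^sup>2) = 1" .
    moreover have "\<omega> (\<lambda>i. if i < m then x i else 0) w = \<omega> x w" for w
      by (rule bil_cong) auto
    ultimately have "(\<lambda>i. 1 / sqrt ?s * (if i < m then x i else 0)) \<in> K"
      unfolding K_def using that(1) by (simp only: bil_scale_left mem_Collect_eq) auto
    then show ?thesis using pos by (intro exI[of _ "1 / sqrt ?s"]) auto
  qed
  have nz: "\<exists>i<m. x i \<noteq> 0" "\<exists>i<m. y i \<noteq> 0" if "\<omega> x y \<noteq> 0" for x y
    using that bil_nonzero by blast+
  define g where "g = (\<lambda>p. \<omega> (fst p) (snd p) / (sqrt (q (fst p) (fst p)) * sqrt (q (snd p) (snd p))))"
  have "continuous_on (K \<times> K) g"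
    unfolding g_def
  proof (intro continuous_intros ballI)
    fix p assume "p \<in> K \<times> K"
    then show "sqrt (q (fst p) (fst p)) * sqrt (q (snd p) (snd p)) \<noteq> 0"
      using K_pos[of "fst p"] K_pos[of "snd p"] by auto
  qed
  moreover have "K \<times> K \<noteq> {}"
    using normalize[OF assms(1) nz(1)[of x0 y0]] assms(3) by auto
  ultimately obtain p where p: "p \<in> K \<times> K" "\<And>p'. p' \<in> K \<times> K \<Longrightarrow> g p' \<le> g p"
    using continuous_attains_sup[of "K \<times> K" g] K compact_Times by blast
  define \<mu> where "\<mu> = g p"
  have bound: "\<omega> a b \<le> \<mu> * (sqrt (q a a) * sqrt (q b b))"
    if ab_C: "\<forall>w\<in>C. \<omega> a w = 0" "\<forall>w\<in>C. \<omega> b w = 0" for a b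
  \<comment> \<open>If one of the vectors vanishes below \<open>m\<close>, both sides are 0;
    otherwise both can be rescaled into \<open>K\<close>.\<close>
  proof (cases "(\<exists>i<m. a i \<noteq> 0) \<and> (\<exists>i<m. b i \<noteq> 0)")
    case False
    then have "\<omega> a b = 0" "q a a = 0 \<or> q b b = 0" by (auto simp: bil_def)
    then show ?thesis by auto
  next
    case True
    obtain c where c: "c > 0" "(\<lambda>i. c * (if i < m then a i else 0)) \<in> K" (is "?a \<in> K")
      using normalize[OF ab_C(1)] True by blast
    obtain c' where c': "c' > 0" "(\<lambda>i. c' * (if i < m then b i else 0)) \<in> K" (is "?b \<in> K")
      using normalize[OF ab_C(2)] True by blast
    have ab: "bil m M (\<lambda>i. if i < m then x i else 0) (\<lambda>i. if i < m then y i else 0) = bil m M x y"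
      for M x y by (rule bil_cong) auto
    have g: "g (?a, ?b) \<le> \<mu>" using c c' p(2) by (simp add: \<mu>_def)
    have "q a a > 0" "q b b > 0" using True Q_pos by auto
    have "g (?a, ?b) = \<omega> a b / (sqrt (q a a) * sqrt (q b b))"
      using c(1) c'(1) unfolding g_def fst_conv snd_conv bil_scale_left bil_scale_right ab
      by (simp add: real_sqrt_mult real_sqrt_mult_self flip: mult.assoc[of "sqrt _" "sqrt _"])
    with g show ?thesis
      using \<open>q a a > 0\<close> \<open>q b b > 0\<close> by (simp add: pos_divide_le_eq)
  qed
  \<comment> \<open>The pair \<open>x0\<close>, \<open>y0\<close> is what makes the maximum
    positive.\<close>
  have "0 < \<mu> * (sqrt (q x0 x0) * sqrt (q y0 y0))"
    using bound[OF assms(1,2)] assms(3) by linarith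
  moreover have "0 < sqrt (q x0 x0) * sqrt (q y0 y0)"
    using nz[of x0 y0] assms(3) Q_pos by auto
  ultimately have "0 < \<mu>" by (rule zero_less_mult_pos2)
  obtain x y where xy: "p = (x, y)" "x \<in> K" "y \<in> K" using p(1) by auto
  let ?x = "\<lambda>i. 1 / sqrt (q x x) * x i" and ?y = "\<lambda>i. 1 / sqrt (q y y) * y i"
  have "q x x > 0" "q y y > 0" using K_pos xy by auto
  show ?thesis
  proof (rule that[of \<mu> ?x ?y])
    show "\<forall>w\<in>C. \<omega> ?x w = 0" "\<forall>w\<in>C. \<omega> ?y w = 0"
      using xy by (auto simp: K_def bil_scale_left simp del: times_divide_eq_left)
    show "q ?x ?x = 1" "q ?y ?y = 1"
      using \<open>q x x > 0\<close> \<open>q y y > 0\<close>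
      unfolding bil_scale_left bil_scale_right by (simp_all add: field_simps)
    show "\<omega> ?x ?y = \<mu>"
      unfolding bil_scale_left bil_scale_right by (simp add: \<mu>_def g_def xy(1))
  qed (use \<open>0 < \<mu>\<close> bound in auto)
qed

text \<open>Moving \<open>y\<close> along a direction \<open>q\<close>-orthogonal to
  \<open>y\<close> changes its \<open>q\<close>-norm only to second order, so maximality rules out a
  first order change of \<open>\<omega>\<close>; likewise for \<open>x\<close>.\<close>

lemma maximizer_first_order:
  assumes "\<forall>w\<in>C. \<omega> x0 w = 0" "\<forall>w\<in>C. \<omega> y0 w = 0" "0 < \<omega> x0 y0"
  obtains \<mu> x y where "0 < \<mu>" "\<forall>w\<in>C. \<omega> x w = 0" "\<forall>w\<in>C. \<omega> y w = 0"
    "q x x = 1" "q y y = 1"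
    "\<And>z. \<forall>w\<in>C. \<omega> z w = 0 \<Longrightarrow> \<omega> x z = \<mu> * q y z"
    "\<And>z. \<forall>w\<in>C. \<omega> z w = 0 \<Longrightarrow> \<omega> z y = \<mu> * q x z"
proof -
  obtain \<mu> x y where \<mu>: "0 < \<mu>" and xC: "\<forall>w\<in>C. \<omega> x w = 0" and yC: "\<forall>w\<in>C. \<omega> y w = 0"
    and qx: "q x x = 1" and qy: "q y y = 1" and xy: "\<omega> x y = \<mu>"
    and bound: "\<And>a b. \<forall>w\<in>C. \<omega> a w = 0 \<Longrightarrow> \<forall>w\<in>C. \<omega> b w = 0 \<Longrightarrow>
      \<omega> a b \<le> \<mu> * (sqrt (q a a) * sqrt (q b b))"
    by (rule normalized_maximizer[OF assms]) (rule that)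
  show ?thesis
  proof (rule that[OF \<mu> xC yC qx qy])
    fix z assume z: "\<forall>w\<in>C. \<omega> z w = 0"
    \<comment> \<open>The \<open>q\<close>-component along \<open>y\<close> is removed; its
      contribution is known from \<open>\<omega> x y = \<mu>\<close>.\<close>
    let ?w = "\<lambda>i. z i - q y z * y i"
    have q0: "q y ?w = 0" "q ?w y = 0"
      by (simp_all add: bil_diff_right bil_scale_right bil_diff_left bil_scale_left qy q_sym)
    have "\<omega> x ?w = 0"
    proof (rule vanishing_first_order_term[OF \<mu> q_nonneg[of ?w]])
      fix t
      have "\<omega> x (\<lambda>i. 1 * y i + t * ?w i)
          \<le> \<mu> * (sqrt (q x x) * sqrt (q (\<lambda>i. 1 * y i + t * ?w i) (\<lambda>i. 1 * y i + t * ?w i)))"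
        using xC yC z by (intro bound ballI) (simp_all only: bil_left bil_diff_left bil_scale_left, simp_all)
      then show "\<mu> + t * \<omega> x ?w \<le> \<mu> * sqrt (1 + t\<^sup>2 * q ?w ?w)"
        unfolding bil_left bil_right q0 qx qy xy by (simp add: power2_eq_square mult.assoc)
    qed
    then show "\<omega> x z = \<mu> * q y z"
      by (simp add: bil_diff_right bil_scale_right xy)
  next
    fix z assume z: "\<forall>w\<in>C. \<omega> z w = 0"
    let ?w = "\<lambda>i. z i - q x z * x i"
    have q0: "q x ?w = 0" "q ?w x = 0"
      by (simp_all add: bil_diff_right bil_scale_right bil_diff_left bil_scale_left qx q_sym)
    have "\<omega> ?w y = 0"
    proof (rule vanishing_first_order_term[OF \<mu> q_nonneg[of ?w]])
      fix t
      have "\<omega> (\<lambda>i. 1 * x i + t * ?w i) y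
          \<le> \<mu> * (sqrt (q (\<lambda>i. 1 * x i + t * ?w i) (\<lambda>i. 1 * x i + t * ?w i)) * sqrt (q y y))"
        using xC yC z by (intro bound ballI) (simp_all only: bil_left bil_diff_left bil_scale_left, simp_all)
      then show "\<mu> + t * \<omega> ?w y \<le> \<mu> * sqrt (1 + t\<^sup>2 * q ?w ?w)"
        unfolding bil_left bil_right q0 qx qy xy by (simp add: power2_eq_square mult.assoc)
    qed
    then show "\<omega> z y = \<mu> * q x z"
      by (simp add: bil_diff_left bil_scale_left xy)
  qed
qed


text \<open>The last clause makes the symplectic complement of the family \<open>q\<close>-orthogonal to it, so
  that a pair chosen in the complement needs no further orthogonalization.\<close>

definition sympl_family :: "nat \<Rightarrow> (nat \<Rightarrow> nat \<Rightarrow> real) \<Rightarrow> (nat \<Rightarrow> nat \<Rightarrow> real) \<Rightarrow> (nat \<Rightarrow> real) \<Rightarrow> bool" where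
  "sympl_family k e f d \<longleftrightarrow>
     (\<forall>i<k. 0 < d i) \<and>
     (\<forall>i<k. \<forall>j<k. \<omega> (e i) (e j) = 0 \<and> \<omega> (f i) (f j) = 0 \<and> \<omega> (e i) (f j) = of_bool (i = j) \<and>
        q (e i) (e j) = of_bool (i = j) * d i \<and> q (f i) (f j) = of_bool (i = j) * d i \<and>
        q (e i) (f j) = 0) \<and>
     (\<forall>z. (\<forall>i<k. \<omega> z (e i) = 0 \<and> \<omega> z (f i) = 0) \<longrightarrow> (\<forall>i<k. q z (e i) = 0 \<and> q z (f i) = 0))"

text \<open>The complement is nonzero because the projection onto it has positive trace. A vector of
  the complement pairs nontrivially with some \<open>z\<close>, and projecting \<open>z\<close> does
  not change the pairing.\<close>

lemma sympl_family_complement: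
  assumes ef: "sympl_family k e f d" and "2 * k < m"
  obtains x y where "\<forall>w\<in>e ` {..<k} \<union> f ` {..<k}. \<omega> x w = 0"
    "\<forall>w\<in>e ` {..<k} \<union> f ` {..<k}. \<omega> y w = 0" "0 < \<omega> x y"
proof -
  \<comment> \<open>As \<open>\<omega> (e l) (f l) = 1\<close>, the component of \<open>z\<close>
    along \<open>e l\<close> is \<open>\<omega> z (f l)\<close> and the one along \<open>f l\<close>
    is \<open>- \<omega> z (e l)\<close>.\<close>
  define P where "P = (\<lambda>z i. z i - (\<Sum>l<k. \<omega> z (f l) * e l i - \<omega> z (e l) * f l i))"
  have \<omega>_P: "\<omega> (P z) w = \<omega> z w - (\<Sum>l<k. \<omega> z (f l) * \<omega> (e l) w - \<omega> z (e l) * \<omega> (f l) w)" for z w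
    unfolding P_def by (simp add: bil_diff_left bil_sum_left bil_scale_left)
  have ef': "\<omega> (e i) (e j) = 0" "\<omega> (f i) (f j) = 0" "\<omega> (e i) (f j) = of_bool (i = j)"
      "\<omega> (f i) (e j) = - of_bool (i = j)"
    if "i < k" "j < k" for i j
  proof -
    show "\<omega> (e i) (e j) = 0" "\<omega> (f i) (f j) = 0" "\<omega> (e i) (f j) = of_bool (i = j)"
      using ef that unfolding sympl_family_def by blast+
    have "\<omega> (e j) (f i) = of_bool (j = i)"
      using ef that unfolding sympl_family_def by blast
    then show "\<omega> (f i) (e j) = - of_bool (i = j)"
      by (simp add: \<omega>_alt[of "f i" "e j"] eq_commute[of i j])
  qed
  have P_ef: "\<omega> (P z) (e i) = 0" "\<omega> (P z) (f i) = 0" if i: "i < k" for z i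
  proof -
    have "(\<Sum>l<k. \<omega> z (f l) * \<omega> (e l) (e i) - \<omega> z (e l) * \<omega> (f l) (e i)) =
        (\<Sum>l<k. if l = i then \<omega> z (e l) else 0)"
      by (intro sum.cong) (auto simp: ef' i)
    then show "\<omega> (P z) (e i) = 0" using i by (simp add: \<omega>_P)
    have "(\<Sum>l<k. \<omega> z (f l) * \<omega> (e l) (f i) - \<omega> z (e l) * \<omega> (f l) (f i)) =
        (\<Sum>l<k. if l = i then \<omega> z (f l) else 0)"
      by (intro sum.cong) (auto simp: ef' i)
    then show "\<omega> (P z) (f i) = 0" using i by (simp add: \<omega>_P)
  qed
  then have P_orth: "\<forall>w\<in>e ` {..<k} \<union> f ` {..<k}. \<omega> (P z) w = 0" for z
    by auto
  define u where "u = (\<lambda>(j::nat) (i::nat). of_bool (i = j) :: real)"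
  have u_sum: "(\<Sum>j<m. \<omega> (u j) w * x j) = \<omega> x w" for x w
    using bil_unit_sum[of x m W w] by (simp add: u_def mult.commute)
  \<comment> \<open>the symplectic projection \<open>P\<close> onto the complement has trace \<open>m - 2k > 0\<close>\<close>
  have "\<exists>j<m. P (u j) j \<noteq> 0"
  proof (rule ccontr)
    assume "\<not> ?thesis"
    then have "0 = (\<Sum>j<m. P (u j) j)" by simp
    also have "\<dots> = real m - (\<Sum>j<m. \<Sum>l<k. \<omega> (u j) (f l) * e l j - \<omega> (u j) (e l) * f l j)"
      by (simp add: P_def u_def sum_subtractf)
    also have "(\<Sum>j<m. \<Sum>l<k. \<omega> (u j) (f l) * e l j - \<omega> (u j) (e l) * f l j) =
        (\<Sum>l<k. \<Sum>j<m. \<omega> (u j) (f l) * e l j - \<omega> (u j) (e l) * f l j)"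
      by (rule sum.swap)
    also have "\<dots> = (\<Sum>l<k. \<omega> (e l) (f l) - \<omega> (f l) (e l))"
      by (simp only: sum_subtractf u_sum)
    also have "\<dots> = real (2 * k)" by (simp add: ef' cong: sum.cong_simp)
    finally show False using \<open>2 * k < m\<close> by simp
  qed
  then obtain j where j: "j < m" "P (u j) j \<noteq> 0" by auto
  then obtain z where z: "\<omega> (P (u j)) z \<noteq> 0" using W_nondeg by blast
  have "\<omega> (P (u j)) (P z) = - \<omega> (P z) (P (u j))" by (rule \<omega>_alt)
  \<comment> \<open>\<open>z\<close> and \<open>P z\<close> differ by a combination of the pairs,
    all of them orthogonal to \<open>P (u j)\<close>.\<close>
  also have "\<omega> (P z) (P (u j)) = \<omega> z (P (u j))"
    using P_orth[of "u j"] by (simp add: \<omega>_P[of z] \<omega>_alt[of "P (u j)"] ball_Un)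
  also have "- \<omega> z (P (u j)) = \<omega> (P (u j)) z" by (simp add: \<omega>_alt[of z])
  finally have pz: "\<omega> (P (u j)) (P z) \<noteq> 0" using z by simp
  show ?thesis
  proof (cases "0 < \<omega> (P (u j)) (P z)")
    case True
    then show ?thesis using that P_orth by blast
  next
    case False
    then have "0 < \<omega> (P z) (P (u j))" using pz \<omega>_alt[of "P z" "P (u j)"] by linarith
    then show ?thesis using that P_orth by blast
  qed
qed

text \<open>The maximizing pair needs no correction: inserting \<open>x\<close> and \<open>y\<close>
  themselves in the first order conditions gives \<open>\<omega> x y = \<mu>\<close> and
  \<open>q x y = 0\<close>, and lying in the complement gives orthogonality to the old
  pairs.\<close>

lemma sympl_family_Suc:
  assumes ef: "sympl_family k e f d" and "2 * k < m"
  shows "\<exists>e' f' d'. sympl_family (Suc k) e' f' d'"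
proof -
  define C where "C = e ` {..<k} \<union> f ` {..<k}"
  obtain \<mu> x y where \<mu>: "0 < \<mu>" and xC: "\<forall>w\<in>C. \<omega> x w = 0" and yC: "\<forall>w\<in>C. \<omega> y w = 0"
    and qx: "q x x = 1" and qy: "q y y = 1"
    and x: "\<And>z. \<forall>w\<in>C. \<omega> z w = 0 \<Longrightarrow> \<omega> x z = \<mu> * q y z"
    and y: "\<And>z. \<forall>w\<in>C. \<omega> z w = 0 \<Longrightarrow> \<omega> z y = \<mu> * q x z"
  proof -
    obtain x0 y0 where "\<forall>w\<in>C. \<omega> x0 w = 0" "\<forall>w\<in>C. \<omega> y0 w = 0" "0 < \<omega> x0 y0"
      using sympl_family_complement[OF assms] unfolding C_def by blast
    then show thesis
      by (rule maximizer_first_order) (rule that)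
  qed
  have \<omega>_self: "\<omega> z z = 0" for z using \<omega>_alt[of z z] by simp
  have xy: "\<omega> x y = \<mu>" "q x y = 0" "q y x = 0"
    using x[OF yC] x[OF xC] \<mu> qy q_sym[of x y] by (simp_all add: \<omega>_self)
  have C_orth: "q z (e i) = 0" "q z (f i) = 0" if "\<forall>w\<in>C. \<omega> z w = 0" "i < k" for z i
    using ef that by (auto simp: sympl_family_def C_def)
  have \<omega>_C: "\<omega> z (e i) = 0" "\<omega> z (f i) = 0" "\<omega> (e i) z = 0" "\<omega> (f i) z = 0"
    if "\<forall>w\<in>C. \<omega> z w = 0" "i < k" for z i
    using that \<omega>_alt[of "e i" z] \<omega>_alt[of "f i" z] by (auto simp: C_def)
  \<comment> \<open>This scaling turns \<open>\<omega> x y = \<mu>\<close> into 1 and the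
    \<open>q\<close>-values 1 into \<open>1 / \<mu>\<close>, the new entry of
    \<open>d'\<close>.\<close>
  define c where "c = 1 / sqrt \<mu>"
  have c: "c \<noteq> 0" "c * (c * \<mu>) = 1" "c * c = 1 / \<mu>" using \<mu> by (auto simp: c_def field_simps)
  define e' where "e' = e(k := \<lambda>i. c * x i)"
  define f' where "f' = f(k := \<lambda>i. c * y i)"
  define d' where "d' = d(k := 1 / \<mu>)"
  note xyC = C_orth[OF xC] C_orth[OF yC] \<omega>_C[OF xC] \<omega>_C[OF yC]
  have "\<forall>i<Suc k. 0 < d' i"
    using ef \<mu> by (auto simp: d'_def sympl_family_def less_Suc_eq)
  moreover have "\<omega> (e' i) (e' j) = 0 \<and> \<omega> (f' i) (f' j) = 0 \<and> \<omega> (e' i) (f' j) = of_bool (i = j) \<and>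
        q (e' i) (e' j) = of_bool (i = j) * d' i \<and> q (f' i) (f' j) = of_bool (i = j) * d' i \<and>
        q (e' i) (f' j) = 0" if "i < Suc k" "j < Suc k" for i j
  proof -
    consider "i < k" "j < k" | "i = k" "j < k" | "i < k" "j = k" | "i = k" "j = k"
      using \<open>i < Suc k\<close> \<open>j < Suc k\<close> by (metis less_Suc_eq)
    then show ?thesis
    proof cases
      case 1
      then show ?thesis using ef by (simp add: sympl_family_def e'_def f'_def d'_def)
    next
      case 2
      then show ?thesis using xyC by (simp add: e'_def f'_def d'_def bil_scale_left)
    next
      case 3
      then show ?thesis using xyC q_sym[of "e i"] q_sym[of "f i"]
        by (simp add: e'_def f'_def d'_def bil_scale_right)
    next
      case 4
      then show ?thesis using c
        by (simp add: e'_def f'_def d'_def bil_scale_left bil_scale_right \<omega>_self xy qx qy)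
    qed
  qed
  moreover have "q z (e' i) = 0 \<and> q z (f' i) = 0"
    if z: "\<forall>i<Suc k. \<omega> z (e' i) = 0 \<and> \<omega> z (f' i) = 0" and i: "i < Suc k" for z i
  proof -
    have zC: "\<forall>w\<in>C. \<omega> z w = 0"
      using z by (auto simp: C_def e'_def f'_def less_Suc_eq)
    have "\<omega> z x = 0" "\<omega> z y = 0"
      using z c(1) by (auto simp: e'_def f'_def bil_scale_right)
    \<comment> \<open>The first order conditions convert \<open>\<omega>\<close>-orthogonality to
      \<open>x\<close> and \<open>y\<close> into \<open>q\<close>-orthogonality to \<open>y\<close>
      and \<open>x\<close>, which maintains the last clause of \<open>sympl_family\<close>.\<close>
    then have "q z x = 0" "q z y = 0"
      using x[OF zC] y[OF zC] \<mu> \<omega>_alt[of x z] q_sym[of z] by auto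
    then show ?thesis
      using C_orth[OF zC] i by (auto simp: e'_def f'_def less_Suc_eq bil_scale_right)
  qed
  ultimately have "sympl_family (Suc k) e' f' d'"
    unfolding sympl_family_def by blast
  then show ?thesis by blast
qed

lemma sympl_family_exists: "2 * k \<le> m \<Longrightarrow> \<exists>e f d. sympl_family k e f d"
proof (induction k)
  case 0
  then show ?case by (auto simp: sympl_family_def)
next
  case (Suc k)
  then show ?case using sympl_family_Suc by fastforce
qed

end

section \<open>Coefficients and block structure\<close>

text \<open>In the expanded product, \<open>J\<close> collects the factors that contribute their
  constant term; each of the others contributes the square of the variable.\<close>

lemma coeff_prod_quadratic:
  fixes x :: "'i \<Rightarrow> real"
  assumes "finite I"
  shows "coeff (\<Prod>i\<in>I. [:x i, 0, 1:]) m =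
    (\<Sum>J\<in>Pow I. (\<Prod>i\<in>J. x i) * of_bool (m = 2 * card (I - J)))"
proof -
  have pw: "(\<Prod>i\<in>K. monom (1::real) 2) = monom 1 (2 * card K)" for K :: "'i set"
    by (simp add: prod_constant monom_power mult.commute)
  have pc: "(\<Prod>i\<in>K. [:x i:]) = [:\<Prod>i\<in>K. x i:]" for K :: "'i set"
    by (induction K rule: infinite_finite_induct) (auto simp: one_pCons)
  have "(\<Prod>i\<in>I. [:x i, 0, 1:]) = (\<Prod>i\<in>I. [:x i:] + monom 1 2)"
    by (intro prod.cong) (simp_all add: monom_altdef numeral_2_eq_2)
  also have "\<dots> = (\<Sum>J\<in>Pow I. (\<Prod>i\<in>J. [:x i:]) * (\<Prod>i\<in>I - J. monom 1 2))"
    using assms by (rule prod_add)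
  also have "\<dots> = (\<Sum>J\<in>Pow I. Polynomial.smult (\<Prod>i\<in>J. x i) (monom 1 (2 * card (I - J))))"
    by (simp only: pw pc) simp
  finally show ?thesis
    by (simp add: coeff_sum of_bool_def eq_commute[of m] if_distrib cong: if_cong)
qed

lemma coeff_prod_quadratic_odd:
  fixes x :: "'i \<Rightarrow> real"
  assumes "finite I" "odd m"
  shows "coeff (\<Prod>i\<in>I. [:x i, 0, 1:]) m = 0"
  using assms(2) by (auto simp: coeff_prod_quadratic[OF assms(1)] intro!: sum.neutral)

text \<open>Reaching this degree takes exactly \<open>k\<close> constant terms, which yields an
  elementary symmetric sum. The bound on \<open>k\<close> keeps the subtraction from
  truncating.\<close>

lemma coeff_prod_quadratic_even:
  fixes x :: "'i \<Rightarrow> real"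
  assumes "finite I" "k \<le> card I"
  shows "coeff (\<Prod>i\<in>I. [:x i, 0, 1:]) (2 * (card I - k)) =
    (\<Sum>J | J \<subseteq> I \<and> card J = k. \<Prod>i\<in>J. x i)"
proof -
  have "of_bool (2 * (card I - k) = 2 * card (I - J)) = (of_bool (card J = k) :: real)" if "J \<in> Pow I" for J
  proof -
    have "card (I - J) = card I - card J" "card J \<le> card I"
      using that assms by (auto simp: card_Diff_subset finite_subset card_mono)
    then show ?thesis using assms(2) by auto
  qed
  then have "coeff (\<Prod>i\<in>I. [:x i, 0, 1:]) (2 * (card I - k)) =
      (\<Sum>J\<in>Pow I. if card J = k then \<Prod>i\<in>J. x i else 0)"
    unfolding coeff_prod_quadratic[OF assms(1)] by (intro sum.cong) (auto simp: of_bool_def)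
  also have "\<dots> = (\<Sum>J | J \<in> Pow I \<and> card J = k. \<Prod>i\<in>J. x i)"
    using assms(1) by (subst sum.If_cases) (auto simp: Int_def)
  finally show ?thesis by simp
qed

lemma coeff_mult_quadratic:
  "coeff ([:x, 0, 1:] * p) j = x * coeff p j + (if j \<ge> 2 then coeff p (j - 2) else (0::real))"
  by (auto simp: coeff_pCons split: nat.split)

text \<open>Positions \<open>i < n\<close> and \<open>n + i\<close> form a conjugate pair of coordinates.\<close>

abbreviation pair_index :: "nat \<Rightarrow> nat \<Rightarrow> nat" where
  "pair_index n i \<equiv> (if i < n then i else i - n)"

abbreviation partner :: "nat \<Rightarrow> nat \<Rightarrow> nat" where
  "partner n i \<equiv> (if i < n then i + n else i - n)"

text \<open>Swapping each index with its partner permutes the indices and negates the sum. This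
  removes the cross terms in \<open>krylov_output\<close>.\<close>

lemma sum_partner_antisym:
  fixes h :: "nat \<Rightarrow> real"
  assumes "\<And>i. i < 2 * n \<Longrightarrow> h (partner n i) = - h i"
  shows "(\<Sum>i<2 * n. h i) = 0"
proof -
  have "(\<Sum>i<2 * n. h i) = (\<Sum>i<2 * n. h (partner n i))"
    by (rule sum.reindex_bij_witness[of _ "partner n" "partner n"]) (auto split: if_splits)
  also have "\<dots> = - (\<Sum>i<2 * n. h i)"
    by (simp add: assms sum_negf cong: sum.cong_simp)
  finally show ?thesis by simp
qed

section \<open>Entries of the block matrices and of the companion matrix\<close>

lemma J_mat_carrier [simp]: "J_mat n \<in> carrier_mat (2 * n) (2 * n)"
  unfolding J_mat_def mult_2 by (intro four_block_carrier_mat) auto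

lemma block_dbl_carrier [simp]: "block_dbl n f \<in> carrier_mat (2 * n) (2 * n)"
  unfolding block_dbl_def mult_2 by (intro four_block_carrier_mat) auto

lemma J_mat_index:
  "i < 2 * n \<Longrightarrow> j < 2 * n \<Longrightarrow>
   J_mat n $$ (i, j) = (if j = partner n i then if i < n then 1 else - 1 else 0)"
  by (auto simp: J_mat_def)

lemma block_dbl_index:
  "i < 2 * n \<Longrightarrow> j < 2 * n \<Longrightarrow>
   block_dbl n f $$ (i, j) = (if i = j then f (pair_index n i) else 0)"
  by (auto simp: block_dbl_def mat_diag_def)

definition hamil :: "nat \<Rightarrow> real vec \<Rightarrow> real mat" where
  "hamil n d = J_mat n * block_dbl n (\<lambda>i. d $ i)"

abbreviation freq :: "nat \<Rightarrow> real vec \<Rightarrow> nat \<Rightarrow> real" where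
  "freq n d i \<equiv> (if i < n then d $ i else - d $ (i - n))"

lemma hamil_carrier [simp]: "hamil n d \<in> carrier_mat (2 * n) (2 * n)"
  unfolding hamil_def by (rule mult_carrier_mat[OF J_mat_carrier block_dbl_carrier])

lemma hamil_index:
  assumes "i < 2 * n" "j < 2 * n"
  shows "hamil n d $$ (i, j) = (if j = partner n i then freq n d i else 0)"
proof -
  have "hamil n d $$ (i, j) = (\<Sum>k = 0..<2 * n. J_mat n $$ (i, k) * block_dbl n (\<lambda>i. d $ i) $$ (k, j))"
    using assms carrier_matD[OF J_mat_carrier[of n]] carrier_matD[OF block_dbl_carrier[of n]]
    by (simp add: hamil_def scalar_prod_def)
  also have "\<dots> = (\<Sum>k = 0..<2 * n. if k = j then (if j = partner n i then freq n d i else 0) else 0)"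
    using assms by (intro sum.cong) (auto simp: J_mat_index block_dbl_index)
  finally show ?thesis using assms by simp
qed

lemma hamil_mult_index:
  assumes M: "M \<in> carrier_mat (2 * n) k" and ij: "i < 2 * n" "j < k"
  shows "(hamil n d * M) $$ (i, j) = freq n d i * M $$ (partner n i, j)"
proof -
  have p: "partner n i < 2 * n" using ij by auto
  have "(hamil n d * M) $$ (i, j) = (\<Sum>l = 0..<2 * n. hamil n d $$ (i, l) * M $$ (l, j))"
    using M ij carrier_matD[OF hamil_carrier[of n d]] by (simp add: scalar_prod_def)
  also have "\<dots> = (\<Sum>l = 0..<2 * n. if l = partner n i then freq n d i * M $$ (partner n i, j) else 0)"
    using ij by (intro sum.cong) (auto simp: hamil_index)
  finally show ?thesis using p by simp
qed

lemma block_dbl_mult_vec: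
  assumes "v \<in> carrier_vec (2 * n)"
  shows "block_dbl n f *\<^sub>v v = vec (2 * n) (\<lambda>i. f (pair_index n i) * v $ i)"
proof (rule eq_vecI)
  fix i assume i: "i < dim_vec (vec (2 * n) (\<lambda>i. f (pair_index n i) * v $ i))"
  then have "(block_dbl n f *\<^sub>v v) $ i = (\<Sum>l = 0..<2 * n. block_dbl n f $$ (i, l) * v $ l)"
    using assms carrier_matD[OF block_dbl_carrier[of n f]] by (simp add: scalar_prod_def)
  also have "\<dots> = (\<Sum>l = 0..<2 * n. if l = i then f (pair_index n i) * v $ i else 0)"
    using i by (intro sum.cong) (auto simp: block_dbl_index)
  finally show "(block_dbl n f *\<^sub>v v) $ i = vec (2 * n) (\<lambda>i. f (pair_index n i) * v $ i) $ i"
    using i by simp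
qed (use carrier_matD[OF block_dbl_carrier[of n f]] in auto)

lemma g1_ctr_carrier [simp]: "g1_ctr n d \<in> carrier_mat (2 * n) (2 * n)"
  by (simp add: g1_ctr_def)

lemma mult_g1_ctr_index:
  assumes M: "M \<in> carrier_mat k (2 * n)" and ij: "i < k" "j < 2 * n"
  shows "(M * g1_ctr n d) $$ (i, j) =
    (if j = 0 then 0 else M $$ (i, j - 1)) - a_coeff n d j * M $$ (i, 2 * n - 1)"
proof -
  have "(M * g1_ctr n d) $$ (i, j) = (\<Sum>l = 0..<2 * n. M $$ (i, l) * g1_ctr n d $$ (l, j))"
    using M ij carrier_matD[OF g1_ctr_carrier[of n d]] by (simp add: scalar_prod_def)
  \<comment> \<open>At \<open>j = 0\<close> the index \<open>j - 1\<close> truncates to 0; the inner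
    conditional makes that summand 0.\<close>
  also have "\<dots> = (\<Sum>l = 0..<2 * n. (if l = j - 1 then (if j = 0 then 0 else M $$ (i, j - 1)) else 0)
      - (if l = 2 * n - 1 then a_coeff n d j * M $$ (i, 2 * n - 1) else 0))"
    using ij by (intro sum.cong) (auto simp: g1_ctr_def)
  finally show ?thesis using ij by (auto simp: sum_subtractf)
qed

lemma unit_vec_last_mult:
  fixes M :: "real mat"
  assumes M: "M \<in> carrier_mat k (2 * n)" and n: "1 \<le> n"
  shows "M *\<^sub>v unit_vec (2 * n) (2 * n - 1) = col M (2 * n - 1)"
proof (rule eq_vecI)
  fix i assume "i < dim_vec (col M (2 * n - 1))"
  moreover have "2 * n - 1 < 2 * n" using n by simp
  ultimately show "(M *\<^sub>v unit_vec (2 * n) (2 * n - 1)) $ i = col M (2 * n - 1) $ i"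
    using M by simp
qed (use M in auto)

text \<open>The factor is dropped by index and not by root, so repeated frequencies cause no
  trouble.\<close>

definition copoly :: "nat \<Rightarrow> real vec \<Rightarrow> nat \<Rightarrow> real poly" where
  "copoly n d l = (\<Prod>i\<in>{..<n} - {l}. [:(d $ i)\<^sup>2, 0, 1:])"

lemma a_coeff_copoly:
  assumes "l < n"
  shows "a_coeff n d j = (d $ l)\<^sup>2 * coeff (copoly n d l) j
    + (if j \<ge> 2 then coeff (copoly n d l) (j - 2) else 0)"
proof -
  have "(\<Prod>j<n. [:(d $ j)\<^sup>2, 0, 1:]) = [:(d $ l)\<^sup>2, 0, 1:] * copoly n d l"
    unfolding copoly_def using assms by (intro prod.remove) auto
  then show ?thesis
    by (simp only: a_coeff_def coeff_mult_quadratic)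
qed

lemma coeff_copoly_odd: "odd m \<Longrightarrow> coeff (copoly n d l) m = 0"
  by (simp add: copoly_def coeff_prod_quadratic_odd)

lemma f_coeff_copoly:
  assumes "l < n" "k < n"
  shows "f_coeff n d k l = d $ l * coeff (copoly n d l) (2 * (n - 1 - k))"
proof -
  have "card ({..<n} - {l}) = n - 1" using assms by simp
  then show ?thesis
    using coeff_prod_quadratic_even[of "{..<n} - {l}" k "\<lambda>i. (d $ i)\<^sup>2"] assms
    by (simp add: f_coeff_def copoly_def prod_power_distrib)
qed

text \<open>Only the empty set of constant terms reaches this degree. Being monic is what makes the
  last column of \<open>krylov\<close> equal to \<open>w\<close>.\<close>

lemma coeff_copoly_top:
  assumes "l < n"
  shows "coeff (copoly n d l) (2 * n - 2) = 1"
proof -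
  have "card ({..<n} - {l}) = n - 1" using assms by simp
  moreover have "{J. J \<subseteq> {..<n} - {l} \<and> card J = 0} = {{}}"
    by (auto dest: finite_subset)
  ultimately show ?thesis
    using coeff_prod_quadratic_even[of "{..<n} - {l}" 0 "\<lambda>i. (d $ i)\<^sup>2"]
    by (simp add: copoly_def diff_mult_distrib2)
qed

lemma J_mat_mult_index:
  assumes M: "M \<in> carrier_mat (2 * n) k" and ij: "i < 2 * n" "j < k"
  shows "(J_mat n * M) $$ (i, j) = (if i < n then 1 else - 1) * M $$ (partner n i, j)"
proof -
  have p: "partner n i < 2 * n" using ij by auto
  have "(J_mat n * M) $$ (i, j) = (\<Sum>l = 0..<2 * n. J_mat n $$ (i, l) * M $$ (l, j))"
    using M ij carrier_matD[OF J_mat_carrier[of n]] by (simp add: scalar_prod_def)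
  also have "\<dots> = (\<Sum>l = 0..<2 * n.
      if l = partner n i then (if i < n then 1 else - 1) * M $$ (partner n i, j) else 0)"
    using ij by (intro sum.cong) (auto simp: J_mat_index)
  finally show ?thesis using p by simp
qed

section \<open>Symplectic matrices and their inverses\<close>

lemma J_mat_J_mat:
  assumes M: "M \<in> carrier_mat (2 * n) k"
  shows "J_mat n * (J_mat n * M) = - M"
proof (rule eq_matI)
  fix i j assume "i < dim_row (- M)" "j < dim_col (- M)"
  then have ij: "i < 2 * n" "j < k" using M by auto
  then have "partner n i < 2 * n" by auto
  then show "(J_mat n * (J_mat n * M)) $$ (i, j) = (- M) $$ (i, j)"
    using M ij by (subst J_mat_mult_index[OF mult_carrier_mat[OF J_mat_carrier M] ij])
      (auto simp: J_mat_mult_index[OF M] simp del: index_mult_mat)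
qed (use M carrier_matD[OF J_mat_carrier[of n]] in auto)

lemma J_mat_sq: "J_mat n * J_mat n = - 1\<^sub>m (2 * n)"
  using J_mat_J_mat[OF one_carrier_mat[of "2 * n"]] by (simp add: right_mult_one_mat[OF J_mat_carrier])

text \<open>A one-sided inverse of a square matrix is two-sided, so \<open>A\<close> is a unit and
  \<open>mat_inverse\<close> cannot return \<open>None\<close>; uniqueness of inverses does the
  rest.\<close>

lemma mat_inverse_the:
  fixes A B :: "real mat"
  assumes A: "A \<in> carrier_mat m m" and B: "B \<in> carrier_mat m m" and BA: "B * A = 1\<^sub>m m"
  shows "the (mat_inverse A) = B"
proof (cases "mat_inverse A")
  case None
  have "A \<in> Units (ring_mat TYPE(real) m ())"
    using A B BA mat_mult_left_right_inverse[OF B A BA]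
    by (auto simp: Units_def ring_mat_def)
  then show ?thesis using mat_inverse(1)[OF A None, of "()"] by simp
next
  case (Some C)
  then have C: "A * C = 1\<^sub>m m" "C \<in> carrier_mat m m" using mat_inverse(2)[OF A] by auto
  have "C = (B * A) * C" using BA C by simp
  also have "\<dots> = B" using A B C by (simp add: assoc_mult_mat[of _ m m _ m _ m])
  finally show ?thesis using Some by simp
qed

lemma Sp_inverse:
  assumes "S \<in> Sp n"
  shows "matinv S \<in> carrier_mat (2 * n) (2 * n)" "matinv S * S = 1\<^sub>m (2 * n)"
    "S * matinv S = 1\<^sub>m (2 * n)" "J_mat n * S\<^sup>T = matinv S * J_mat n"
proof -
  note assoc = assoc_mult_mat[of _ "2 * n" "2 * n" _ "2 * n" _ "2 * n"]
  have S: "S \<in> carrier_mat (2 * n) (2 * n)" "S\<^sup>T \<in> carrier_mat (2 * n) (2 * n)"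
    and SJS: "S\<^sup>T * (J_mat n * S) = J_mat n"
    using assms by (auto simp: Sp_def assoc)
  \<comment> \<open>By \<open>SJS\<close> and \<open>J_mat_sq\<close> this is a left inverse of
    \<open>S\<close>.\<close>
  define R where "R = - (J_mat n * (S\<^sup>T * J_mat n))"
  have c: "S\<^sup>T * J_mat n \<in> carrier_mat (2 * n) (2 * n)"
      "J_mat n * (S\<^sup>T * J_mat n) \<in> carrier_mat (2 * n) (2 * n)"
    by (meson S J_mat_carrier mult_carrier_mat)+
  then have R: "R \<in> carrier_mat (2 * n) (2 * n)" by (simp add: R_def)
  have "R * S = - (J_mat n * J_mat n)"
    using S c carrier_matD[OF S(1)] carrier_matD[OF c(2)] by (simp add: R_def assoc SJS)
  then have RS: "R * S = 1\<^sub>m (2 * n)" by (simp add: J_mat_sq)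
  have "R * J_mat n = - (J_mat n * (S\<^sup>T * (J_mat n * J_mat n)))"
    using S c carrier_matD[OF c(2)] carrier_matD[OF J_mat_carrier[of n]] by (simp add: R_def assoc)
  also have "\<dots> = J_mat n * S\<^sup>T"
    using S carrier_matD[OF S(2)] carrier_matD[OF J_mat_carrier[of n]] mult_carrier_mat[OF J_mat_carrier S(2)]
    by (simp add: J_mat_sq)
  finally have RJ: "R * J_mat n = J_mat n * S\<^sup>T" .
  have inv: "matinv S = R" by (rule mat_inverse_the[OF S(1) R RS])
  show "matinv S \<in> carrier_mat (2 * n) (2 * n)" "matinv S * S = 1\<^sub>m (2 * n)"
    "S * matinv S = 1\<^sub>m (2 * n)" "J_mat n * S\<^sup>T = matinv S * J_mat n"
    using inv R RS RJ mat_mult_left_right_inverse[OF R S(1) RS] by auto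
qed

lemma Sp_carrier: "S \<in> Sp n \<Longrightarrow> S \<in> carrier_mat (2 * n) (2 * n)"
  by (simp add: Sp_def)

lemma J_mat_williamson:
  assumes "S \<in> Sp n"
  shows "J_mat n * williamson_mat n S d = matinv S * (hamil n d * S)"
proof -
  note assoc = assoc_mult_mat[of _ "2 * n" "2 * n" _ "2 * n" _ "2 * n"]
  note inv = Sp_inverse[OF assms] and S = Sp_carrier[OF assms]
  have c: "S\<^sup>T \<in> carrier_mat (2 * n) (2 * n)" "block_dbl n (\<lambda>i. d $ i) * S \<in> carrier_mat (2 * n) (2 * n)"
    using S mult_carrier_mat[OF block_dbl_carrier] by auto
  have "J_mat n * williamson_mat n S d = (J_mat n * S\<^sup>T) * (block_dbl n (\<lambda>i. d $ i) * S)"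
    using S c by (simp add: williamson_mat_def assoc)
  also have "\<dots> = matinv S * (hamil n d * S)"
    using S c inv(1) unfolding inv(4) by (simp add: hamil_def assoc)
  finally show ?thesis .
qed

text \<open>Write \<open>A\<close> for \<open>s\<close> times \<open>hamil n d\<close> and \<open>p\<close> for the polynomial with coefficients \<open>a_coeff\<close>.
  Column \<open>j\<close> is the vector \<open>\<Sum>k>j. a\<^sub>k A\<^bsup>k-j-1\<^esup> w\<close> of the controller canonical form, where \<open>a\<^bsub>2n\<^esub> = 1\<close>.  On the
  \<open>l\<close>-th pair \<open>A\<^sup>2 = - d\<^sub>l\<^sup>2\<close>, and synthetic division of \<open>p\<close> by \<open>\<lambda>\<^sup>2 + d\<^sub>l\<^sup>2\<close>, whose quotient
  is \<open>copoly n d l\<close>, turns the sum into the two terms below.\<close>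

definition krylov :: "nat \<Rightarrow> real vec \<Rightarrow> real \<Rightarrow> real vec \<Rightarrow> real mat" where
  "krylov n d s w = mat (2 * n) (2 * n) (\<lambda>(i, j).
     (if j = 0 then 0 else coeff (copoly n d (pair_index n i)) (j - 1)) * w $ i +
     coeff (copoly n d (pair_index n i)) j * (s * freq n d i * w $ partner n i))"

lemma krylov_carrier [simp]: "krylov n d s w \<in> carrier_mat (2 * n) (2 * n)"
  by (simp add: krylov_def)

lemma krylov_index:
  "i < 2 * n \<Longrightarrow> j < 2 * n \<Longrightarrow> krylov n d s w $$ (i, j) =
     (if j = 0 then 0 else coeff (copoly n d (pair_index n i)) (j - 1)) * w $ i +
     coeff (copoly n d (pair_index n i)) j * (s * freq n d i * w $ partner n i)"
  by (simp add: krylov_def)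

lemma krylov_last:
  assumes "i < 2 * n"
  shows "krylov n d s w $$ (i, 2 * n - 1) = w $ i"
proof -
  have l: "pair_index n i < n" and "odd (2 * n - 1)" "2 * n - 1 - 1 = 2 * n - 2" using assms by auto
  then show ?thesis
    using assms by (simp add: krylov_index coeff_copoly_top[OF l] coeff_copoly_odd)
qed

text \<open>On each pair, \<open>s\<close> times \<open>hamil n d\<close> sends the two terms of an
  entry into each other, one of them with the factor \<open>- (d $ l)\<^sup>2\<close>. The defect
  from a column shift is then \<open>a_coeff n d j * w $ i\<close> by \<open>a_coeff_copoly\<close>.
  The sign \<open>s\<close> enters squared there, so 1 and \<open>- 1\<close> both serve.\<close>

lemma krylov_mult_g1_ctr:
  assumes "s * s = 1"
  shows "krylov n d s w * g1_ctr n d = s \<cdot>\<^sub>m (hamil n d * krylov n d s w)"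
proof (rule eq_matI)
  fix i j assume "i < dim_row (s \<cdot>\<^sub>m (hamil n d * krylov n d s w))"
    "j < dim_col (s \<cdot>\<^sub>m (hamil n d * krylov n d s w))"
  then have ij: "i < 2 * n" "j < 2 * n"
    using carrier_matD[OF hamil_carrier[of n d]] carrier_matD[OF krylov_carrier[of n d s w]] by auto
  define l where "l = pair_index n i"
  have l: "l < n" and p: "partner n i < 2 * n" "pair_index n (partner n i) = l"
      "partner n (partner n i) = i"
    and fr: "freq n d (partner n i) = - freq n d i" "freq n d i * freq n d i = (d $ l)\<^sup>2"
    using ij by (auto simp: l_def power2_eq_square)
  let ?r = "coeff (copoly n d l)"
  have "(s \<cdot>\<^sub>m (hamil n d * krylov n d s w)) $$ (i, j) = s * freq n d i * krylov n d s w $$ (partner n i, j)"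
    using ij hamil_mult_index[OF krylov_carrier ij, of d d s w] carrier_matD[OF hamil_carrier[of n d]]
      carrier_matD[OF krylov_carrier[of n d s w]]
    by simp
  also have "\<dots> = (if j = 0 then 0 else ?r (j - 1)) * (s * freq n d i * w $ partner n i)
      - (s * s) * (freq n d i * freq n d i) * (?r j * w $ i)"
    unfolding krylov_index[OF p(1) ij(2)] p fr(1) by (simp only: algebra_simps)
  also have "\<dots> = (if j = 0 then 0 else krylov n d s w $$ (i, j - 1)) - a_coeff n d j * w $ i"
    using ij assms
    by (auto simp: krylov_index a_coeff_copoly[OF l] fr(2) algebra_simps numeral_2_eq_2 simp flip: l_def)
  also have "\<dots> = (krylov n d s w * g1_ctr n d) $$ (i, j)"
    by (simp only: mult_g1_ctr_index[OF krylov_carrier ij] krylov_last[OF ij(1)])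
  finally show "(krylov n d s w * g1_ctr n d) $$ (i, j) = (s \<cdot>\<^sub>m (hamil n d * krylov n d s w)) $$ (i, j)"
    by simp
qed (use carrier_matD[OF hamil_carrier[of n d]] carrier_matD[OF krylov_carrier[of n d s w]]
       carrier_matD[OF g1_ctr_carrier[of n d]] in auto)

text \<open>\<open>copoly\<close> has only even coefficients, so one formula covers both parities:
  the zeros at even positive \<open>j\<close> appear because \<open>j - 1\<close> is odd, and for
  odd \<open>j\<close> the index \<open>k\<close> of \<open>c_odd\<close> satisfies
  \<open>j - 1 = 2 * (n - 1 - k)\<close>.\<close>

lemma g2_ctr_index:
  assumes v: "v \<in> carrier_vec (2 * n)" and j: "j < 2 * n"
  shows "g2_ctr n d v $ j = (\<Sum>i<2 * n. (if j = 0 then 0 else coeff (copoly n d (pair_index n i)) (j - 1))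
    * (d $ pair_index n i * (v $ i)\<^sup>2))"
proof (cases "odd j")
  case True
  define k where "k = (2 * n - j - 1) div 2"
  have k: "k < n" "j - 1 = 2 * (n - 1 - k)" "j \<noteq> 0"
    using True j by (auto simp: k_def elim!: oddE)
  have "g2_ctr n d v $ j = (\<Sum>i<2 * n. v $ i * (f_coeff n d k (pair_index n i) * v $ i))"
    using True j v by (simp add: g2_ctr_def c_odd_def block_dbl_mult_vec k_def scalar_prod_def lessThan_atLeast0)
  also have "\<dots> = (\<Sum>i<2 * n. (if j = 0 then 0 else coeff (copoly n d (pair_index n i)) (j - 1))
    * (d $ pair_index n i * (v $ i)\<^sup>2))"
  proof (rule sum.cong)
    fix i assume "i \<in> {..<2 * n}"
    then have "pair_index n i < n" by auto
    then show "v $ i * (f_coeff n d k (pair_index n i) * v $ i) =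
      (if j = 0 then 0 else coeff (copoly n d (pair_index n i)) (j - 1)) * (d $ pair_index n i * (v $ i)\<^sup>2)"
      using k(3) by (simp only: f_coeff_copoly[OF _ k(1)] k(2)) (simp add: power2_eq_square)
  qed simp
  finally show ?thesis .
next
  case False
  then have "odd (j - 1)" if "j \<noteq> 0" using that by (cases j) auto
  then show ?thesis using False j by (simp add: g2_ctr_def coeff_copoly_odd)
qed

text \<open>The terms mixing \<open>w\<close> at the partner with \<open>u\<close> cancel in pairs,
  because \<open>freq\<close> changes sign while \<open>sym\<close> keeps the product; the diagonal
  terms are those of \<open>g2_ctr_index\<close>. Part (i) takes \<open>v\<close> for
  \<open>w\<close> and the doubled diagonal matrix times \<open>v\<close> for \<open>u\<close>; part
  (ii) exchanges the two.\<close>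

lemma krylov_output:
  assumes v: "v \<in> carrier_vec (2 * n)" and w: "w \<in> carrier_vec (2 * n)" and u: "u \<in> carrier_vec (2 * n)"
    and wu: "\<And>i. i < 2 * n \<Longrightarrow> w $ i * u $ i = d $ pair_index n i * (v $ i)\<^sup>2"
    and sym: "\<And>i. i < 2 * n \<Longrightarrow> w $ partner n i * u $ i = w $ i * u $ partner n i"
  shows "(krylov n d s w)\<^sup>T *\<^sub>v u = g2_ctr n d v"
proof (rule eq_vecI)
  fix j assume "j < dim_vec (g2_ctr n d v)"
  then have j: "j < 2 * n" by (simp add: g2_ctr_def)
  let ?r = "\<lambda>i. coeff (copoly n d (pair_index n i))"
  have "((krylov n d s w)\<^sup>T *\<^sub>v u) $ j = (\<Sum>i<2 * n. krylov n d s w $$ (i, j) * u $ i)"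
    using j u carrier_matD[OF krylov_carrier[of n d s w]]
    by (simp add: scalar_prod_def lessThan_atLeast0)
  also have "\<dots> = (\<Sum>i<2 * n. (if j = 0 then 0 else ?r i (j - 1)) * (w $ i * u $ i)
      + ?r i j * s * freq n d i * (w $ partner n i * u $ i))"
    using j by (intro sum.cong refl) (simp only: krylov_index lessThan_iff algebra_simps)
  also have "\<dots> = (\<Sum>i<2 * n. (if j = 0 then 0 else ?r i (j - 1)) * (w $ i * u $ i))
      + (\<Sum>i<2 * n. ?r i j * s * freq n d i * (w $ partner n i * u $ i))"
    by (rule sum.distrib)
  also have "(\<Sum>i<2 * n. ?r i j * s * freq n d i * (w $ partner n i * u $ i)) = 0"
  proof (rule sum_partner_antisym)
    fix i assume i: "i < 2 * n"
    then have "pair_index n (partner n i) = pair_index n i" "partner n (partner n i) = i"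
      "freq n d (partner n i) = - freq n d i" by auto
    then show "?r (partner n i) j * s * freq n d (partner n i) * (w $ partner n (partner n i) * u $ partner n i)
        = - (?r i j * s * freq n d i * (w $ partner n i * u $ i))"
      unfolding sym[OF i] by (simp only: mult_minus_right mult_minus_left)
  qed
  also have "(\<Sum>i<2 * n. (if j = 0 then 0 else ?r i (j - 1)) * (w $ i * u $ i)) = g2_ctr n d v $ j"
    unfolding g2_ctr_index[OF v j] by (intro sum.cong refl) (simp only: wu lessThan_iff)
  finally show "((krylov n d s w)\<^sup>T *\<^sub>v u) $ j = g2_ctr n d v $ j" by simp
qed (simp add: g2_ctr_def carrier_matD[OF krylov_carrier[of n d s w]])

section \<open>Characteristic polynomials\<close>

lemma char_poly_hamil:
  "char_poly (hamil n d) = (\<Prod>j<n. [:(d $ j)\<^sup>2, 0, 1:])"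
proof -
  let ?X = "mat_diag n (\<lambda>_. [:0, 1:]) :: real poly mat"
  let ?D = "\<lambda>s. mat_diag n (\<lambda>i. [:s * d $ i:]) :: real poly mat"
  \<comment> \<open>All four blocks are diagonal and commute, so the determinant reduces to that of
    an \<open>n\<close> by \<open>n\<close> diagonal matrix.\<close>
  have "char_poly_matrix (hamil n d) = four_block_mat ?X (?D (- 1)) (?D 1) ?X"
  proof (rule eq_matI)
    fix i j assume "i < dim_row (four_block_mat ?X (?D (- 1)) (?D 1) ?X)"
      "j < dim_col (four_block_mat ?X (?D (- 1)) (?D 1) ?X)"
    then have ij: "i < 2 * n" "j < 2 * n" by (auto simp: mat_diag_def)
    then show "char_poly_matrix (hamil n d) $$ (i, j) = four_block_mat ?X (?D (- 1)) (?D 1) ?X $$ (i, j)"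
      using carrier_matD[OF hamil_carrier[of n d]]
      by (auto simp: char_poly_matrix_def hamil_index mat_diag_def)
  qed (use carrier_matD[OF hamil_carrier[of n d]] in \<open>auto simp: char_poly_matrix_def mat_diag_def\<close>)
  then have "char_poly (hamil n d) = det (?X * ?X - ?D (- 1) * ?D 1)"
    unfolding char_poly_def by (simp only: det_four_block_mat[of _ n] mat_diag_dim mat_diag_diag mult.commute)
  also have "?X * ?X - ?D (- 1) * ?D 1 = mat_diag n (\<lambda>i. [:(d $ i)\<^sup>2, 0, 1:])"
    by (rule eq_matI) (auto simp: mat_diag_diag, auto simp: mat_diag_def power2_eq_square)
  also have "det \<dots> = prod_list (diag_mat (mat_diag n (\<lambda>i. [:(d $ i)\<^sup>2, 0, 1:])))"
    by (rule det_upper_triangular[of _ n]) (auto simp: upper_triangular_def mat_diag_def)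
  also have "\<dots> = (\<Prod>j<n. [:(d $ j)\<^sup>2, 0, 1:])"
    by (simp add: diag_mat_def mat_diag_def prod.distinct_set_conv_list[symmetric] lessThan_atLeast0
        cong: map_cong)
  finally show ?thesis .
qed

lemma char_poly_J_mat_williamson:
  assumes "S \<in> Sp n"
  shows "char_poly (J_mat n * williamson_mat n S d) = (\<Prod>j<n. [:(d $ j)\<^sup>2, 0, 1:])"
proof -
  note inv = Sp_inverse[OF assms] and S = Sp_carrier[OF assms]
  have J: "J_mat n * williamson_mat n S d = matinv S * hamil n d * S"
    using inv S by (simp add: J_mat_williamson[OF assms] assoc_mult_mat[of _ "2 * n" "2 * n" _ "2 * n" _ "2 * n"])
  have "matinv S * hamil n d * S \<in> carrier_mat (2 * n) (2 * n)"
    by (meson inv(1) S hamil_carrier mult_carrier_mat)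
  then have "similar_mat_wit (J_mat n * williamson_mat n S d) (hamil n d) (matinv S) S"
    unfolding J using inv S by (intro similar_mat_witI[of _ _ "2 * n"]) auto
  then show ?thesis
    using char_poly_similar char_poly_hamil unfolding similar_mat_def by metis
qed

lemma a_coeff_unique:
  assumes "S \<in> Sp n" "S' \<in> Sp n" "williamson_mat n S d = williamson_mat n S' d'"
  shows "a_coeff n d = a_coeff n d'"
  using char_poly_J_mat_williamson[OF assms(1), of d] char_poly_J_mat_williamson[OF assms(2), of d'] assms(3)
  by (simp add: a_coeff_def fun_eq_iff)

section \<open>Linear maps, system morphisms and positive definiteness\<close>

lemma linear_map_mult_mat_vec:
  assumes "F \<in> carrier_mat m m"
  shows "linear_map_on_vecs m (\<lambda>z. F *\<^sub>v z)"
proof -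
  have "(\<lambda>z. F *\<^sub>v z) \<in> LinearCombinations.module_hom class_ring (module_vec TYPE(real) m) (module_vec TYPE(real) m)"
    using assms by (auto simp: LinearCombinations.module_hom_def module_vec_simps mult_add_distrib_mat_vec mult_mat_vec)
  then show ?thesis
    using vec_vs[where 'a = real, of m]
    by (simp add: linear_map_def mod_hom_def mod_hom_axioms_def vectorspace_def)
qed

lemma system_morphism_mult_mat_vec:
  assumes F: "F \<in> carrier_mat m m" and A: "A \<in> carrier_mat m m" "A' \<in> carrier_mat m m"
    and b: "b \<in> carrier_vec m" and FA: "F * A = A' * F" and Fb: "F *\<^sub>v b = b'"
    and h: "\<And>z. z \<in> carrier_vec m \<Longrightarrow> h z = h' (F *\<^sub>v z)"
  shows "system_morphism (linear_system m A b h) (linear_system m A' b' h') (\<lambda>z. F *\<^sub>v z)"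
proof -
  have "F *\<^sub>v (A *\<^sub>v z + u \<cdot>\<^sub>v b) = A' *\<^sub>v (F *\<^sub>v z) + u \<cdot>\<^sub>v b'" if z: "z \<in> carrier_vec m" for z u
  proof -
    have "F *\<^sub>v (A *\<^sub>v z + u \<cdot>\<^sub>v b) = (F * A) *\<^sub>v z + u \<cdot>\<^sub>v (F *\<^sub>v b)"
      using F A b z by (simp add: mult_add_distrib_mat_vec[of _ m m] mult_mat_vec[of _ m m]
          assoc_mult_mat_vec[of _ m m _ m])
    then show ?thesis using F A z by (simp add: FA Fb assoc_mult_mat_vec[of _ m m _ m])
  qed
  then show ?thesis
    using F h by (auto simp: linear_system_def)
qed

lemma williamson_carrier:
  assumes "S \<in> carrier_mat (2 * n) (2 * n)"
  shows "williamson_mat n S d \<in> carrier_mat (2 * n) (2 * n)"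
  unfolding williamson_mat_def using assms
  by (meson block_dbl_carrier mult_carrier_mat transpose_carrier_mat)

lemma williamson_mult_vec:
  assumes "S \<in> carrier_mat (2 * n) (2 * n)" "x \<in> carrier_vec (2 * n)"
  shows "williamson_mat n S d *\<^sub>v x = S\<^sup>T *\<^sub>v (block_dbl n (\<lambda>i. d $ i) *\<^sub>v (S *\<^sub>v x))"
proof -
  have c: "S\<^sup>T \<in> carrier_mat (2 * n) (2 * n)" "S\<^sup>T * block_dbl n (\<lambda>i. d $ i) \<in> carrier_mat (2 * n) (2 * n)"
    using assms mult_carrier_mat[OF _ block_dbl_carrier] by auto
  have "S *\<^sub>v x \<in> carrier_vec (2 * n)" using assms by auto
  then show ?thesis
    unfolding williamson_mat_def
    using assms c by (simp add: assoc_mult_mat_vec[of _ "2 * n" "2 * n" _ "2 * n"])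
qed

lemma block_dbl_transpose: "(block_dbl n f)\<^sup>T = block_dbl n f"
  using carrier_matD[OF block_dbl_carrier[of n f]]
  by (intro eq_matI) (auto simp: block_dbl_index)

text \<open>Substituting \<open>y = S *\<^sub>v x\<close>, which is nonzero since \<open>S\<close>
  is invertible, leaves a weighted sum of squares.\<close>

lemma sym_pos_def_williamson:
  assumes S: "S \<in> Sp n" and d: "\<forall>i<n. 0 < d $ i"
  shows "sym_pos_def (2 * n) (williamson_mat n S d)"
  unfolding sym_pos_def_def
proof (intro conjI ballI impI)
  note c = Sp_carrier[OF S]
  show "williamson_mat n S d \<in> carrier_mat (2 * n) (2 * n)" by (rule williamson_carrier[OF c])
  have c': "S\<^sup>T \<in> carrier_mat (2 * n) (2 * n)" using c by simp
  show "(williamson_mat n S d)\<^sup>T = williamson_mat n S d"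
    unfolding williamson_mat_def
    using c c' mult_carrier_mat[OF block_dbl_carrier c]
    by (simp add: transpose_mult[of _ "2 * n" "2 * n" _ "2 * n"] block_dbl_transpose
        assoc_mult_mat[of _ "2 * n" "2 * n" _ "2 * n" _ "2 * n"])
  fix x :: "real vec" assume x: "x \<in> carrier_vec (2 * n)" "x \<noteq> 0\<^sub>v (2 * n)"
  define y where "y = S *\<^sub>v x"
  have y: "y \<in> carrier_vec (2 * n)" using c x by (auto simp: y_def)
  have "matinv S *\<^sub>v y = x"
    using Sp_inverse[OF S] c x by (simp add: y_def flip: assoc_mult_mat_vec[of _ "2 * n" "2 * n" _ "2 * n"])
  moreover have "matinv S *\<^sub>v 0\<^sub>v (2 * n) = 0\<^sub>v (2 * n)"
    using Sp_inverse(1)[OF S] by (intro eq_vecI) auto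
  ultimately have "y \<noteq> 0\<^sub>v (2 * n)" using x(2) by auto
  then obtain i where i: "i < 2 * n" "y $ i \<noteq> 0" using y by (metis eq_vecI carrier_vecD index_zero_vec)
  have "x \<bullet> (williamson_mat n S d *\<^sub>v x) = (S\<^sup>T *\<^sub>v (block_dbl n (\<lambda>i. d $ i) *\<^sub>v y)) \<bullet> x"
    using comm_scalar_prod[OF x(1) mult_mat_vec_carrier[OF williamson_carrier[OF c] x(1)]]
    by (simp add: williamson_mult_vec[OF c x(1)] y_def)
  also have "\<dots> = (block_dbl n (\<lambda>i. d $ i) *\<^sub>v y) \<bullet> y"
    unfolding y_def[symmetric]
    using transpose_vec_mult_scalar[OF c x(1), of "block_dbl n (\<lambda>i. d $ i) *\<^sub>v y"]
      mult_mat_vec_carrier[OF block_dbl_carrier y] by (simp add: y_def)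
  also have "\<dots> = (\<Sum>i = 0..<2 * n. d $ pair_index n i * (y $ i)\<^sup>2)"
    using y by (simp add: block_dbl_mult_vec scalar_prod_def power2_eq_square mult.assoc)
  also have "\<dots> > 0"
  proof (rule sum_pos2[of _ i])
    have pos: "0 < d $ pair_index n k" if "k < 2 * n" for k
      using that by (auto intro!: d[rule_format])
    show "0 < d $ pair_index n i * (y $ i)\<^sup>2" using pos[OF i(1)] i(2) by simp
    show "0 \<le> d $ pair_index n k * (y $ k)\<^sup>2" if "k \<in> {0..<2 * n}" for k
      using pos[of k] that by simp
  qed (use i in auto)
  finally show "0 < x \<bullet> (williamson_mat n S d *\<^sub>v x)" .
qed

section \<open>Williamson normal form\<close>

lemma scalar_prod_mat_mult_vec:
  assumes M: "M \<in> carrier_mat m m" and x: "x \<in> carrier_vec m" "y \<in> carrier_vec m"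
  shows "x \<bullet> (M *\<^sub>v y) = (\<Sum>i<m. \<Sum>j<m. x $ i * M $$ (i, j) * (y $ j :: real))"
  using assms by (simp add: scalar_prod_def sum_distrib_left lessThan_atLeast0 mult.assoc)

lemma bil_vec:
  assumes "M \<in> carrier_mat m m"
  shows "bil m (\<lambda>i j. M $$ (i, j)) x y = vec m x \<bullet> (M *\<^sub>v vec m y)"
  using assms by (simp add: scalar_prod_mat_mult_vec bil_def)

text \<open>Through the matrix with columns \<open>t j\<close>, the relations of a symplectic family
  become matrix identities.\<close>

lemma congruence_index:
  assumes M: "M \<in> carrier_mat m m" and ij: "i < m" "j < m"
  shows "((mat m m (\<lambda>(i, j). t j i))\<^sup>T * (M * mat m m (\<lambda>(i, j). t j i))) $$ (i, j)
    = bil m (\<lambda>i j. M $$ (i, j)) (t i) (t j)"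
proof -
  let ?T = "mat m m (\<lambda>(i, j). t j i)"
  have "(?T\<^sup>T * (M * ?T)) $$ (i, j) = row ?T\<^sup>T i \<bullet> col (M * ?T) j"
    using M ij by simp
  also have "row ?T\<^sup>T i = vec m (t i)" using ij by (intro eq_vecI) auto
  also have "col (M * ?T) j = M *\<^sub>v vec m (t j)"
    using M ij by (intro eq_vecI) (auto simp: scalar_prod_def)
  finally show ?thesis by (simp add: bil_vec[OF M])
qed

lemma sympl_pos_J_mat:
  assumes Q: "sym_pos_def (2 * n) Q"
  shows "sympl_pos (2 * n) (\<lambda>i j. Q $$ (i, j)) (\<lambda>i j. J_mat n $$ (i, j))"
proof
  have Qc: "Q \<in> carrier_mat (2 * n) (2 * n)" and Qt: "Q\<^sup>T = Q" using Q by (auto simp: sym_pos_def_def)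
  show "Q $$ (j, i) = Q $$ (i, j)" if "i < 2 * n" "j < 2 * n" for i j
    using that Qc Qt by (metis carrier_matD index_transpose_mat(1))
  show "0 < bil (2 * n) (\<lambda>i j. Q $$ (i, j)) x x" if "i < 2 * n" "x i \<noteq> 0" for x i
  proof -
    have "vec (2 * n) x \<noteq> 0\<^sub>v (2 * n)" using that by (metis index_vec index_zero_vec(1))
    then show ?thesis using Q unfolding bil_vec[OF Qc] by (simp add: sym_pos_def_def)
  qed
  show "J_mat n $$ (j, i) = - J_mat n $$ (i, j)" if "i < 2 * n" "j < 2 * n" for i j
    using that by (auto simp: J_mat_index)
  show "\<exists>y. bil (2 * n) (\<lambda>i j. J_mat n $$ (i, j)) x y \<noteq> 0" if i: "i < 2 * n" "x i \<noteq> 0" for x i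
  proof
    \<comment> \<open>Pairing with the unit vector at the partner position extracts
      \<open>x i\<close> up to sign.\<close>
    have "bil (2 * n) (\<lambda>i j. J_mat n $$ (i, j)) x (\<lambda>k. of_bool (k = partner n i))
      = (\<Sum>k<2 * n. \<Sum>l<2 * n. if l = partner n i \<and> k = i then (if i < n then 1 else - 1) * x i else 0)"
      unfolding bil_def using i by (intro sum.cong refl) (auto simp: J_mat_index split: if_splits)
    also have "\<dots> = (\<Sum>k<2 * n. if k = i then (if i < n then 1 else - 1) * x i else 0)"
      using i by (intro sum.cong refl) auto
    also have "\<dots> = (if i < n then 1 else - 1) * x i" using i by simp
    finally show "bil (2 * n) (\<lambda>i j. J_mat n $$ (i, j)) x (\<lambda>k. of_bool (k = partner n i)) \<noteq> 0"
      using i by simp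
  qed
qed

text \<open>The matrix \<open>T\<close> with columns \<open>e\<close> followed by \<open>f\<close>
  is symplectic and brings \<open>Q\<close> to doubled diagonal form by congruence; \<open>S\<close>
  is its inverse.\<close>

lemma williamson_normal_form:
  assumes Q: "sym_pos_def (2 * n) Q"
  obtains S d where "S \<in> Sp n" "d \<in> carrier_vec n" "\<forall>i<n. 0 < d $ i" "Q = williamson_mat n S d"
proof -
  have Qc: "Q \<in> carrier_mat (2 * n) (2 * n)" using Q by (auto simp: sym_pos_def_def)
  note assoc = assoc_mult_mat[of _ "2 * n" "2 * n" _ "2 * n" _ "2 * n"]
  interpret sympl_pos "2 * n" "\<lambda>i j. Q $$ (i, j)" "\<lambda>i j. J_mat n $$ (i, j)"
    by (rule sympl_pos_J_mat[OF Q])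
  obtain e f d0 where fam: "sympl_family n e f d0" using sympl_family_exists[of n] by auto
  define t where "t = (\<lambda>j. if j < n then e j else f (j - n))"
  define T where "T = mat (2 * n) (2 * n) (\<lambda>(i, j). t j i)"
  define d where "d = vec n d0"
  let ?D = "block_dbl n (\<lambda>i. d $ i)"
  have fam': "\<omega> (e i) (e j) = 0" "\<omega> (f i) (f j) = 0" "\<omega> (e i) (f j) = of_bool (i = j)"
      "\<omega> (f i) (e j) = - of_bool (i = j)" "q (e i) (e j) = of_bool (i = j) * d0 i"
      "q (f i) (f j) = of_bool (i = j) * d0 i" "q (e i) (f j) = 0" "q (f i) (e j) = 0"
    if "i < n" "j < n" for i j
  proof -
    have *: "\<forall>i<n. \<forall>j<n. \<omega> (e i) (e j) = 0 \<and> \<omega> (f i) (f j) = 0 \<and> \<omega> (e i) (f j) = of_bool (i = j) \<and>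
        q (e i) (e j) = of_bool (i = j) * d0 i \<and> q (f i) (f j) = of_bool (i = j) * d0 i \<and>
        q (e i) (f j) = 0"
      using fam unfolding sympl_family_def by blast
    show "\<omega> (e i) (e j) = 0" "\<omega> (f i) (f j) = 0" "\<omega> (e i) (f j) = of_bool (i = j)"
      "q (e i) (e j) = of_bool (i = j) * d0 i"
      "q (f i) (f j) = of_bool (i = j) * d0 i" "q (e i) (f j) = 0"
      using * that by blast+
    have "\<omega> (e j) (f i) = of_bool (j = i)" "q (e j) (f i) = 0" using * that by blast+
    then show "\<omega> (f i) (e j) = - of_bool (i = j)" "q (f i) (e j) = 0"
      by (simp_all add: \<omega>_alt[of "f i" "e j"] q_sym[of "f i" "e j"] eq_commute[of i j])
  qed
  have T: "T \<in> carrier_mat (2 * n) (2 * n)" "T\<^sup>T \<in> carrier_mat (2 * n) (2 * n)" by (simp_all add: T_def)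
  have TJT: "T\<^sup>T * (J_mat n * T) = J_mat n"
  proof (rule eq_matI)
    fix i j assume "i < dim_row (J_mat n)" "j < dim_col (J_mat n)"
    then have ij: "i < 2 * n" "j < 2 * n" using carrier_matD[OF J_mat_carrier[of n]] by auto
    show "(T\<^sup>T * (J_mat n * T)) $$ (i, j) = J_mat n $$ (i, j)"
      unfolding T_def congruence_index[OF J_mat_carrier ij] J_mat_index[OF ij]
      using ij by (auto simp: t_def fam')
  qed (use T carrier_matD[OF J_mat_carrier[of n]] in auto)
  have TQT: "T\<^sup>T * (Q * T) = ?D"
  proof (rule eq_matI)
    fix i j assume "i < dim_row ?D" "j < dim_col ?D"
    then have ij: "i < 2 * n" "j < 2 * n" using carrier_matD[OF block_dbl_carrier[of n "\<lambda>i. d $ i"]] by auto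
    show "(T\<^sup>T * (Q * T)) $$ (i, j) = ?D $$ (i, j)"
      unfolding T_def congruence_index[OF Qc ij] block_dbl_index[OF ij]
      using ij by (auto simp: t_def fam' d_def)
  qed (use T Qc carrier_matD[OF block_dbl_carrier[of n "\<lambda>i. d $ i"]] in auto)
  have TSp: "T \<in> Sp n" using T TJT by (simp add: Sp_def assoc)
  define S where "S = matinv T"
  note S_inv = Sp_inverse[OF TSp, folded S_def]
  have St: "S\<^sup>T \<in> carrier_mat (2 * n) (2 * n)" using S_inv(1) by simp
  have StTt: "S\<^sup>T * T\<^sup>T = 1\<^sub>m (2 * n)"
    using transpose_mult[OF T(1) S_inv(1)] S_inv(3) by simp
  \<comment> \<open>This undoes the congruence by \<open>T\<close>. For \<open>J_mat n\<close> it
    shows that \<open>S\<close> is symplectic, for \<open>Q\<close> it gives the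
    decomposition.\<close>
  have conjugate: "S\<^sup>T * (T\<^sup>T * (M * T)) * S = M" if M: "M \<in> carrier_mat (2 * n) (2 * n)" for M
  proof -
    have "M * T \<in> carrier_mat (2 * n) (2 * n)" using M T by simp
    then have "S\<^sup>T * (T\<^sup>T * (M * T)) = (S\<^sup>T * T\<^sup>T) * (M * T)"
      using T St by (simp add: assoc)
    also have "\<dots> = M * T" using M T by (simp add: StTt)
    finally show ?thesis using M T S_inv by (simp add: assoc)
  qed
  have "S \<in> Sp n" using conjugate[OF J_mat_carrier] S_inv(1) by (simp add: Sp_def TJT)
  moreover have "Q = williamson_mat n S d" using conjugate[OF Qc] by (simp add: williamson_mat_def TQT)
  moreover have "d \<in> carrier_vec n" "\<forall>i<n. 0 < d $ i"
    using fam by (auto simp: d_def sympl_family_def)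
  ultimately show ?thesis using that by blast
qed

section \<open>Morphisms\<close>

text \<open>Read columnwise, \<open>K G = G g1_ctr\<close> is a recursion that computes each column of \<open>G\<close> from the
  next one and the last one.\<close>

lemma mult_g1_ctr_unique:
  assumes K: "K \<in> carrier_mat (2 * n) (2 * n)"
    and G: "G \<in> carrier_mat (2 * n) (2 * n)" "K * G = G * g1_ctr n d"
    and G': "G' \<in> carrier_mat (2 * n) (2 * n)" "K * G' = G' * g1_ctr n d"
    and last: "col G (2 * n - 1) = col G' (2 * n - 1)"
  shows "G = G'"
proof -
  have last': "G $$ (i, 2 * n - 1) = G' $$ (i, 2 * n - 1)" if "i < 2 * n" for i
    using that G(1) G'(1) arg_cong[OF last, of "\<lambda>v. v $ i"] by simp
  have step: "M $$ (i, j - 1) = row K i \<bullet> col M j + a_coeff n d j * M $$ (i, 2 * n - 1)"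
    if "M \<in> carrier_mat (2 * n) (2 * n)" "K * M = M * g1_ctr n d" "i < 2 * n" "j < 2 * n" "j \<noteq> 0" for M i j
  proof -
    have "row K i \<bullet> col M j = (M * g1_ctr n d) $$ (i, j)"
      unfolding that(2)[symmetric] using K that(1,3,4) by simp
    also have "\<dots> = (if j = 0 then 0 else M $$ (i, j - 1)) - a_coeff n d j * M $$ (i, 2 * n - 1)"
      by (rule mult_g1_ctr_index[OF that(1,3,4)])
    finally show ?thesis using that(5) by simp
  qed
  have "k < 2 * n \<longrightarrow> col G (2 * n - 1 - k) = col G' (2 * n - 1 - k)" for k
  proof (induction k)
    case 0
    then show ?case using last by simp
  next
    case (Suc k)
    show ?case
    proof
      assume k: "Suc k < 2 * n"
      define j where "j = 2 * n - 1 - k"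
      have j: "j < 2 * n" "j \<noteq> 0" "2 * n - 1 - Suc k = j - 1" using k by (auto simp: j_def)
      have IH: "col G j = col G' j" using Suc k by (simp add: j_def)
      show "col G (2 * n - 1 - Suc k) = col G' (2 * n - 1 - Suc k)"
        unfolding j(3)
      proof (rule eq_vecI)
        fix i assume "i < dim_vec (col G' (j - 1))"
        then have i: "i < 2 * n" using G' by simp
        show "col G (j - 1) $ i = col G' (j - 1) $ i"
          using step[OF G i j(1,2)] step[OF G' i j(1,2)] i j G(1) G'(1) IH last'[OF i] by simp
      qed (use G G' in simp)
    qed
  qed
  note cols = this
  show ?thesis
  proof (rule eq_matI)
    fix i j assume "i < dim_row G'" "j < dim_col G'"
    then have ij: "i < 2 * n" "j < 2 * n" using G' by auto
    then have "col G j = col G' j" using cols[of "2 * n - 1 - j"] by simp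
    then have "col G j $ i = col G' j $ i" by simp
    then show "G $$ (i, j) = G' $$ (i, j)" using ij G(1) G'(1) by simp
  qed (use G G' in auto)
qed

section \<open>Intertwining matrices and the two morphisms\<close>

lemma hamil_transpose: "(hamil n d)\<^sup>T = - hamil n d"
  using carrier_matD[OF hamil_carrier[of n d]]
  by (intro eq_matI) (auto simp: hamil_index)

lemma col_krylov_last:
  assumes "1 \<le> n" "w \<in> carrier_vec (2 * n)"
  shows "col (krylov n d s w) (2 * n - 1) = w"
  using assms carrier_matD[OF krylov_carrier[of n d s w]]
  by (intro eq_vecI) (auto simp: krylov_last simp del: One_nat_def)

definition ctr_mat :: "nat \<Rightarrow> real mat \<Rightarrow> real vec \<Rightarrow> real vec \<Rightarrow> real mat" where
  "ctr_mat n S d v = matinv S * krylov n d 1 v"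

text \<open>Transposition turns \<open>hamil n d\<close> into its negative, which the sign
  \<open>- 1\<close> compensates. The vector given to \<open>krylov\<close> makes the last row equal
  to \<open>B\<^sup>T Q\<close> when \<open>v = S *\<^sub>v B\<close>.\<close>

definition obs_mat :: "nat \<Rightarrow> real mat \<Rightarrow> real vec \<Rightarrow> real vec \<Rightarrow> real mat" where
  "obs_mat n S d v = (krylov n d (- 1) (block_dbl n (\<lambda>i. d $ i) *\<^sub>v v))\<^sup>T * S"

lemma ctr_mat_carrier: "S \<in> Sp n \<Longrightarrow> ctr_mat n S d v \<in> carrier_mat (2 * n) (2 * n)"
  unfolding ctr_mat_def by (meson Sp_inverse(1) krylov_carrier mult_carrier_mat)

lemma obs_mat_carrier: "S \<in> Sp n \<Longrightarrow> obs_mat n S d v \<in> carrier_mat (2 * n) (2 * n)"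
  unfolding obs_mat_def by (meson Sp_carrier krylov_carrier mult_carrier_mat transpose_carrier_mat)

text \<open>The intertwining identity of \<open>krylov\<close> is transported by
  \<open>matinv S\<close>. The last column of \<open>krylov\<close> is \<open>v\<close>, so the
  input vector goes to \<open>matinv S *\<^sub>v v\<close>. The outputs agree by
  \<open>krylov_output\<close>.\<close>

lemma ctr_morphism:
  assumes n: "1 \<le> n" and S: "S \<in> Sp n" and v: "v \<in> carrier_vec (2 * n)"
  shows "system_morphism (theta_CH n (d, v))
    (theta_PH n (williamson_mat n S d, matinv S *\<^sub>v v)) (\<lambda>z. ctr_mat n S d v *\<^sub>v z)"
proof -
  let ?W = "krylov n d 1 v" and ?D = "block_dbl n (\<lambda>i. d $ i)"
  note assoc = assoc_mult_mat[of _ "2 * n" "2 * n" _ "2 * n" _ "2 * n"]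
  note assoc_vec = assoc_mult_mat_vec[of _ "2 * n" "2 * n" _ "2 * n"]
  note S_inv = Sp_inverse[OF S] and Sc = Sp_carrier[OF S]
  have one: "1 \<cdot>\<^sub>m M = M" for M :: "real mat" by (intro eq_matI) auto
  have HW: "hamil n d * ?W \<in> carrier_mat (2 * n) (2 * n)" "hamil n d * S \<in> carrier_mat (2 * n) (2 * n)"
    using mult_carrier_mat[OF hamil_carrier] Sc by auto
  have W_g1: "?W * g1_ctr n d = hamil n d * ?W"
    using krylov_mult_g1_ctr[of 1 n d v] by (simp add: one)
  have SW: "S * ctr_mat n S d v = ?W"
    using Sc S_inv by (simp add: ctr_mat_def left_mult_one_mat[OF krylov_carrier] flip: assoc)
  have "ctr_mat n S d v * g1_ctr n d = matinv S * (hamil n d * ?W)"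
    using S_inv(1) by (simp add: ctr_mat_def assoc W_g1)
  also have "\<dots> = J_mat n * williamson_mat n S d * ctr_mat n S d v"
    unfolding J_mat_williamson[OF S]
    using S_inv(1) Sc HW ctr_mat_carrier[OF S, of d v] by (simp add: assoc SW)
  finally have 1: "ctr_mat n S d v * g1_ctr n d = J_mat n * williamson_mat n S d * ctr_mat n S d v" .
  have 2: "ctr_mat n S d v *\<^sub>v unit_vec (2 * n) (2 * n - 1) = matinv S *\<^sub>v v"
    unfolding ctr_mat_def assoc_vec[OF S_inv(1) krylov_carrier unit_vec_carrier]
      unit_vec_last_mult[OF krylov_carrier n] col_krylov_last[OF n v] ..
  have 3: "g2_ctr n d v \<bullet> z = (matinv S *\<^sub>v v) \<bullet> (williamson_mat n S d *\<^sub>v (ctr_mat n S d v *\<^sub>v z))"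
    if z: "z \<in> carrier_vec (2 * n)" for z
  proof -
    have Dv: "?D *\<^sub>v v \<in> carrier_vec (2 * n)" by (rule mult_mat_vec_carrier[OF block_dbl_carrier v])
    have Wz: "?W *\<^sub>v z \<in> carrier_vec (2 * n)" by (rule mult_mat_vec_carrier[OF krylov_carrier z])
    have Fz: "ctr_mat n S d v *\<^sub>v z \<in> carrier_vec (2 * n)"
      by (rule mult_mat_vec_carrier[OF ctr_mat_carrier[OF S] z])
    have DW: "?D *\<^sub>v (?W *\<^sub>v z) \<in> carrier_vec (2 * n)" by (rule mult_mat_vec_carrier[OF block_dbl_carrier Wz])
    have Sv: "matinv S *\<^sub>v v \<in> carrier_vec (2 * n)" by (rule mult_mat_vec_carrier[OF S_inv(1) v])
    have "?W\<^sup>T *\<^sub>v (?D *\<^sub>v v) = g2_ctr n d v"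
      by (rule krylov_output[OF v v Dv]) (auto simp: block_dbl_mult_vec[OF v] power2_eq_square)
    then have "g2_ctr n d v \<bullet> z = (?D *\<^sub>v v) \<bullet> (?W *\<^sub>v z)"
      using transpose_vec_mult_scalar[OF krylov_carrier z Dv, of d 1 v] by simp
    also have "\<dots> = v \<bullet> (?D *\<^sub>v (?W *\<^sub>v z))"
      using transpose_vec_mult_scalar[OF block_dbl_carrier Wz v] by (simp add: block_dbl_transpose)
    also have "?W *\<^sub>v z = S *\<^sub>v (ctr_mat n S d v *\<^sub>v z)"
      using assoc_vec[OF Sc ctr_mat_carrier[OF S] z, of d v] by (simp add: SW)
    \<comment> \<open>Writing \<open>v\<close> as \<open>S *\<^sub>v (matinv S *\<^sub>v v)\<close>
      and moving \<open>S\<close> across the scalar product reassembles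
      \<open>williamson_mat\<close>.\<close>
    also have "v \<bullet> (?D *\<^sub>v (S *\<^sub>v (ctr_mat n S d v *\<^sub>v z)))
        = (matinv S *\<^sub>v v) \<bullet> (S\<^sup>T *\<^sub>v (?D *\<^sub>v (S *\<^sub>v (ctr_mat n S d v *\<^sub>v z))))"
    proof -
      have St: "S\<^sup>T \<in> carrier_mat (2 * n) (2 * n)" using Sc by simp
      have X: "?D *\<^sub>v (S *\<^sub>v (ctr_mat n S d v *\<^sub>v z)) \<in> carrier_vec (2 * n)"
        by (meson Sc Fz block_dbl_carrier mult_mat_vec_carrier)
      have "S *\<^sub>v (matinv S *\<^sub>v v) = v"
        using assoc_vec[OF Sc S_inv(1) v] v by (simp add: S_inv(3))
      then show ?thesis
        using transpose_vec_mult_scalar[OF St X Sv] by simp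
    qed
    finally show ?thesis
      by (simp add: williamson_mult_vec[OF Sc Fz])
  qed
  show ?thesis
    unfolding theta_CH.simps theta_PH.simps
    by (rule system_morphism_mult_mat_vec)
      (rule ctr_mat_carrier[OF S] g1_ctr_carrier mult_carrier_mat[OF J_mat_carrier williamson_carrier[OF Sc]]
        unit_vec_carrier 1 2 3 | assumption)+
qed

lemma g1_obs_carrier: "g1_obs n d \<in> carrier_mat (2 * n) (2 * n)"
  by (simp add: g1_obs_def)

lemma obs_mat_intertwines:
  assumes S: "S \<in> Sp n"
  shows "obs_mat n S d v * (J_mat n * williamson_mat n S d) = g1_obs n d * obs_mat n S d v"
proof -
  let ?U = "krylov n d (- 1) (block_dbl n (\<lambda>i. d $ i) *\<^sub>v v)"
  note assoc = assoc_mult_mat[of _ "2 * n" "2 * n" _ "2 * n" _ "2 * n"]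
  note S_inv = Sp_inverse[OF S] and Sc = Sp_carrier[OF S]
  have Ut: "?U\<^sup>T \<in> carrier_mat (2 * n) (2 * n)" by simp
  have g: "(g1_ctr n d)\<^sup>T \<in> carrier_mat (2 * n) (2 * n)" by simp
  have HS: "hamil n d * S \<in> carrier_mat (2 * n) (2 * n)" by (rule mult_carrier_mat[OF hamil_carrier Sc])
  have "obs_mat n S d v * (J_mat n * williamson_mat n S d) = ?U\<^sup>T * (S * (matinv S * (hamil n d * S)))"
    unfolding J_mat_williamson[OF S] obs_mat_def
    using Ut Sc mult_carrier_mat[OF S_inv(1) HS] by (simp only: assoc)
  also have "S * (matinv S * (hamil n d * S)) = hamil n d * S"
    using Sc S_inv HS by (simp add: left_mult_one_mat[OF hamil_carrier] flip: assoc)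
  also have "?U\<^sup>T * (hamil n d * S) = (?U\<^sup>T * hamil n d) * S"
    using Ut Sc by (simp add: assoc)
  also have "?U\<^sup>T * hamil n d = (g1_ctr n d)\<^sup>T * ?U\<^sup>T"
  proof -
    have neg: "(- 1 \<cdot>\<^sub>m M)\<^sup>T = - M\<^sup>T" for M :: "real mat" by (intro eq_matI) auto
    have neg2: "- (- M) = M" for M :: "real mat" by (intro eq_matI) auto
    have "(?U * g1_ctr n d)\<^sup>T = - (hamil n d * ?U)\<^sup>T"
      unfolding krylov_mult_g1_ctr[of "- 1" n d, simplified] neg ..
    then have "(g1_ctr n d)\<^sup>T * ?U\<^sup>T = - (?U\<^sup>T * - hamil n d)"
      unfolding transpose_mult[OF krylov_carrier g1_ctr_carrier] transpose_mult[OF hamil_carrier krylov_carrier]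
        hamil_transpose .
    also have "?U\<^sup>T * - hamil n d = - (?U\<^sup>T * hamil n d)"
      by (rule uminus_mult_right_mat) (use carrier_matD[OF Ut] carrier_matD[OF hamil_carrier[of n d]] in simp)
    finally show ?thesis by (simp add: neg2)
  qed
  also have "(g1_ctr n d)\<^sup>T * ?U\<^sup>T * S = g1_obs n d * obs_mat n S d v"
    unfolding g1_obs_def obs_mat_def using g Ut Sc by (simp only: assoc)
  finally show ?thesis .
qed

lemma obs_mat_input:
  assumes S: "S \<in> Sp n" and B: "B \<in> carrier_vec (2 * n)"
  shows "obs_mat n S d (S *\<^sub>v B) *\<^sub>v B = g2_obs n d (S *\<^sub>v B)"
proof -
  let ?v = "S *\<^sub>v B" and ?D = "block_dbl n (\<lambda>i. d $ i)"
  note Sc = Sp_carrier[OF S]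
  have v: "?v \<in> carrier_vec (2 * n)" by (rule mult_mat_vec_carrier[OF Sc B])
  have Dv: "?D *\<^sub>v ?v \<in> carrier_vec (2 * n)" by (rule mult_mat_vec_carrier[OF block_dbl_carrier v])
  have c: "(krylov n d (- 1) (?D *\<^sub>v ?v))\<^sup>T \<in> carrier_mat (2 * n) (2 * n)" by simp
  have "(krylov n d (- 1) (?D *\<^sub>v ?v))\<^sup>T *\<^sub>v ?v = g2_ctr n d ?v"
    using v by (intro krylov_output[OF v Dv v])
      (auto simp: block_dbl_mult_vec[OF v] power2_eq_square simp del: index_mult_mat_vec)
  then show ?thesis
    unfolding obs_mat_def g2_obs_def assoc_mult_mat_vec[OF c Sc B] .
qed

text \<open>The last column of \<open>krylov\<close> is its vector argument, so the last row of
  \<open>obs_mat\<close> depends on \<open>Q\<close> and \<open>B\<close> alone. It supplies the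
  output equation and the hypothesis on last columns in \<open>mult_g1_ctr_unique\<close>.\<close>

lemma obs_mat_transpose_last:
  assumes n: "1 \<le> n" and S: "S \<in> Sp n" and B: "B \<in> carrier_vec (2 * n)"
  shows "(obs_mat n S d (S *\<^sub>v B))\<^sup>T *\<^sub>v unit_vec (2 * n) (2 * n - 1) = williamson_mat n S d *\<^sub>v B"
proof -
  let ?w = "block_dbl n (\<lambda>i. d $ i) *\<^sub>v (S *\<^sub>v B)"
  let ?U = "krylov n d (- 1) ?w"
  note Sc = Sp_carrier[OF S]
  have w: "?w \<in> carrier_vec (2 * n)" by (meson B Sc block_dbl_carrier mult_mat_vec_carrier)
  have c: "?U\<^sup>T \<in> carrier_mat (2 * n) (2 * n)" "S\<^sup>T \<in> carrier_mat (2 * n) (2 * n)" using Sc by simp_all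
  have "(obs_mat n S d (S *\<^sub>v B))\<^sup>T *\<^sub>v unit_vec (2 * n) (2 * n - 1)
      = S\<^sup>T *\<^sub>v (?U *\<^sub>v unit_vec (2 * n) (2 * n - 1))"
    unfolding obs_mat_def transpose_mult[OF c(1) Sc]
    using assoc_mult_mat_vec[OF c(2) krylov_carrier unit_vec_carrier] by simp
  also have "?U *\<^sub>v unit_vec (2 * n) (2 * n - 1) = ?w"
    unfolding unit_vec_last_mult[OF krylov_carrier n] col_krylov_last[OF n w] ..
  finally show ?thesis by (simp add: williamson_mult_vec[OF Sc B])
qed

lemma obs_morphism:
  assumes n: "1 \<le> n" and S: "S \<in> Sp n" and d: "\<forall>i<n. 0 < d $ i" and B: "B \<in> carrier_vec (2 * n)"
  shows "system_morphism (theta_PH n (williamson_mat n S d, B)) (theta_OH n (d, S *\<^sub>v B))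
    (\<lambda>z. obs_mat n S d (S *\<^sub>v B) *\<^sub>v z)"
proof -
  let ?F = "obs_mat n S d (S *\<^sub>v B)" and ?Q = "williamson_mat n S d"
  note Sc = Sp_carrier[OF S]
  have Q: "?Q \<in> carrier_mat (2 * n) (2 * n)" "?Q\<^sup>T = ?Q"
    using sym_pos_def_williamson[OF S d] by (simp_all add: sym_pos_def_def)
  have F: "?F \<in> carrier_mat (2 * n) (2 * n)" by (rule obs_mat_carrier[OF S])
  have out: "B \<bullet> (?Q *\<^sub>v z) = unit_vec (2 * n) (2 * n - 1) \<bullet> (?F *\<^sub>v z)"
    if z: "z \<in> carrier_vec (2 * n)" for z
    using transpose_vec_mult_scalar[OF Q(1) z B] transpose_vec_mult_scalar[OF F z unit_vec_carrier[of "2 * n" "2 * n - 1"]]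
    unfolding obs_mat_transpose_last[OF n S B] Q(2) by simp
  show ?thesis
    unfolding theta_OH.simps theta_PH.simps
    by (rule system_morphism_mult_mat_vec)
      (rule F mult_carrier_mat[OF J_mat_carrier Q(1)] g1_obs_carrier B obs_mat_intertwines[OF S]
        obs_mat_input[OF S B] out | assumption)+
qed

text \<open>The two decompositions may have different \<open>d\<close> and \<open>S\<close>, but
  both matrices intertwine the same \<open>J Q\<close> with the same companion matrix and share
  their last row. Hence they coincide, and so do their values at \<open>B\<close>, which are the
  input vectors.\<close>

lemma theta_OH_unique:
  assumes n: "1 \<le> n" and S: "S \<in> Sp n" "S' \<in> Sp n" and B: "B \<in> carrier_vec (2 * n)"
    and eq: "williamson_mat n S d = williamson_mat n S' d'"
  shows "theta_OH n (d, S *\<^sub>v B) = theta_OH n (d', S' *\<^sub>v B)"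
proof -
  let ?F = "obs_mat n S d (S *\<^sub>v B)" and ?F' = "obs_mat n S' d' (S' *\<^sub>v B)"
  let ?A = "J_mat n * williamson_mat n S d"
  have F: "?F \<in> carrier_mat (2 * n) (2 * n)" "?F' \<in> carrier_mat (2 * n) (2 * n)"
    using obs_mat_carrier S by auto
  have A: "?A \<in> carrier_mat (2 * n) (2 * n)"
    by (rule mult_carrier_mat[OF J_mat_carrier williamson_carrier[OF Sp_carrier[OF S(1)]]])
  have g1: "g1_ctr n d' = g1_ctr n d"
    unfolding g1_ctr_def a_coeff_unique[OF S eq] ..
  have g1c: "(g1_ctr n d)\<^sup>T \<in> carrier_mat (2 * n) (2 * n)" by simp
  have tr: "?A\<^sup>T * M\<^sup>T = M\<^sup>T * g1_ctr n d"
    if "M \<in> carrier_mat (2 * n) (2 * n)" "M * ?A = (g1_ctr n d)\<^sup>T * M" for M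
    using arg_cong[OF that(2), of transpose_mat] transpose_mult[OF that(1) A] transpose_mult[OF g1c that(1)]
    by simp
  have "?F\<^sup>T = ?F'\<^sup>T"
  proof (rule mult_g1_ctr_unique)
    show "?A\<^sup>T * ?F\<^sup>T = ?F\<^sup>T * g1_ctr n d"
      using obs_mat_intertwines[OF S(1)] by (intro tr F) (simp add: g1_obs_def)
    show "?A\<^sup>T * ?F'\<^sup>T = ?F'\<^sup>T * g1_ctr n d"
      unfolding eq using obs_mat_intertwines[OF S(2), of d'] by (intro tr[unfolded eq] F) (simp add: g1_obs_def g1)
    show "col ?F\<^sup>T (2 * n - 1) = col ?F'\<^sup>T (2 * n - 1)"
    proof -
      have "?F\<^sup>T \<in> carrier_mat (2 * n) (2 * n)" "?F'\<^sup>T \<in> carrier_mat (2 * n) (2 * n)" using F by simp_all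
      from this[THEN unit_vec_last_mult, OF n] show ?thesis
        using obs_mat_transpose_last[OF n S(1) B, of d] obs_mat_transpose_last[OF n S(2) B, of d'] eq
        by simp
    qed
  qed (use A F in auto)
  then have "?F = ?F'" by (metis transpose_transpose)
  then have "g2_obs n d (S *\<^sub>v B) = g2_obs n d' (S' *\<^sub>v B)"
    using obs_mat_input[OF S(1) B, of d] obs_mat_input[OF S(2) B, of d'] by simp
  then show ?thesis by (simp add: g1_obs_def g1)
qed

theorem theorem3p3:
  fixes n :: nat
  assumes "n \<ge> 1"
  shows
    "(\<forall>S\<in>Sp n. \<exists>\<phi>\<in>Theta_CH n \<rightarrow> PH n.
        (\<forall>(d, v)\<in>Theta_CH n.
           \<phi> (d, v) = theta_PH n (williamson_mat n S d, matinv S *\<^sub>v v) \<and>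
           (\<exists>f. linear_map_on_vecs (2*n) f \<and>
                system_morphism (theta_CH n (d, v)) (\<phi> (d, v)) f)) \<and>
        (\<exists>\<psi>\<in>CH n \<rightarrow> PH n. \<forall>s\<in>CH n. \<exists>p\<in>Theta_CH n. s = theta_CH n p \<and> \<psi> s = \<phi> p))
     \<and>
     (\<forall>(Q, B)\<in>Theta_PH n. \<exists>f. linear_map_on_vecs (2*n) f \<and>
        (\<exists>S\<in>Sp n. \<exists>d. (d, S *\<^sub>v B) \<in> Theta_OH n \<and> Q = williamson_mat n S d) \<and>
        (\<forall>S\<in>Sp n. \<forall>d. (d, S *\<^sub>v B) \<in> Theta_OH n \<and> Q = williamson_mat n S d \<longrightarrow>
           theta_OH n (d, S *\<^sub>v B) \<in> OH n \<and>
           system_morphism (theta_PH n (Q, B)) (theta_OH n (d, S *\<^sub>v B)) f))"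
proof (intro conjI ballI)
  fix S assume S: "S \<in> Sp n"
  define \<phi> where "\<phi> = (\<lambda>(d, v). theta_PH n (williamson_mat n S d, matinv S *\<^sub>v v))"
  have \<phi>: "\<phi> \<in> Theta_CH n \<rightarrow> PH n"
  proof
    fix p assume p: "p \<in> Theta_CH n"
    obtain d v where "p = (d, v)" by (cases p)
    then have "\<forall>i<n. 0 < d $ i" "v \<in> carrier_vec (2 * n)" using p by (auto simp: Theta_CH_def)
    then have "(williamson_mat n S d, matinv S *\<^sub>v v) \<in> Theta_PH n"
      using sym_pos_def_williamson[OF S] mult_mat_vec_carrier[OF Sp_inverse(1)[OF S]] by (simp add: Theta_PH_def)
    then show "\<phi> p \<in> PH n" by (simp only: \<phi>_def \<open>p = (d, v)\<close> PH_def prod.case image_eqI)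
  qed
  moreover have "\<exists>f. linear_map_on_vecs (2*n) f \<and> system_morphism (theta_CH n (d, v)) (\<phi> (d, v)) f"
    if "(d, v) \<in> Theta_CH n" for d v
  proof -
    have "v \<in> carrier_vec (2 * n)" using that by (simp add: Theta_CH_def)
    from ctr_morphism[OF assms S this, of d] linear_map_mult_mat_vec[OF ctr_mat_carrier[OF S, of d v]]
    show ?thesis by (auto simp only: \<phi>_def prod.case)
  qed
  moreover have "\<exists>\<psi>\<in>CH n \<rightarrow> PH n. \<forall>s\<in>CH n. \<exists>p\<in>Theta_CH n. s = theta_CH n p \<and> \<psi> s = \<phi> p"
  proof -
    \<comment> \<open>\<open>theta_CH n\<close> is not injective, as \<open>v\<close> and
      \<open>- v\<close> give the same system, so a map on systems needs a chosen parameter for each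
      of them.\<close>
    define r where "r = inv_into (Theta_CH n) (theta_CH n)"
    have r: "r s \<in> Theta_CH n" "theta_CH n (r s) = s" if "s \<in> CH n" for s
      using that unfolding r_def CH_def by (auto intro: inv_into_into f_inv_into_f)
    show ?thesis
      using r \<phi> by (intro bexI[of _ "\<phi> \<circ> r"]) (auto intro!: bexI[of _ "r _"])
  qed
  ultimately show "\<exists>\<phi>\<in>Theta_CH n \<rightarrow> PH n.
      (\<forall>(d, v)\<in>Theta_CH n.
         \<phi> (d, v) = theta_PH n (williamson_mat n S d, matinv S *\<^sub>v v) \<and>
         (\<exists>f. linear_map_on_vecs (2*n) f \<and>
              system_morphism (theta_CH n (d, v)) (\<phi> (d, v)) f)) \<and>
      (\<exists>\<psi>\<in>CH n \<rightarrow> PH n. \<forall>s\<in>CH n. \<exists>p\<in>Theta_CH n. s = theta_CH n p \<and> \<psi> s = \<phi> p)"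
    by (intro bexI[of _ \<phi>]) (auto simp: \<phi>_def simp del: theta_CH.simps theta_PH.simps)
next
  fix p assume p: "p \<in> Theta_PH n"
  obtain Q B where QB: "p = (Q, B)" by (cases p)
  then have Q: "sym_pos_def (2 * n) Q" and B: "B \<in> carrier_vec (2 * n)"
    using p by (auto simp: Theta_PH_def)
  obtain S d where S: "S \<in> Sp n" and d: "d \<in> carrier_vec n" "\<forall>i<n. 0 < d $ i"
    and Qd: "Q = williamson_mat n S d"
    using williamson_normal_form[OF Q] .
  have 1: "(d, S *\<^sub>v B) \<in> Theta_OH n"
    using d mult_mat_vec_carrier[OF Sp_carrier[OF S] B] by (simp add: Theta_OH_def Theta_CH_def)
  have 2: "linear_map_on_vecs (2 * n) (\<lambda>z. obs_mat n S d (S *\<^sub>v B) *\<^sub>v z)"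
    by (rule linear_map_mult_mat_vec[OF obs_mat_carrier[OF S]])
  \<comment> \<open>One map serves every decomposition of \<open>Q\<close>: its matrix is built from
    the fixed \<open>S\<close> and \<open>d\<close>, and by \<open>theta_OH_unique\<close> the
    target system does not change.\<close>
  have 3: "theta_OH n (d', S' *\<^sub>v B) \<in> OH n \<and>
      system_morphism (theta_PH n (Q, B)) (theta_OH n (d', S' *\<^sub>v B)) (\<lambda>z. obs_mat n S d (S *\<^sub>v B) *\<^sub>v z)"
    if S': "S' \<in> Sp n" and d': "(d', S' *\<^sub>v B) \<in> Theta_OH n" and Qd': "Q = williamson_mat n S' d'" for S' d'
    using obs_morphism[OF assms S d(2) B] theta_OH_unique[OF assms S S' B, of d d'] d' Qd Qd'
    by (metis OH_def imageI)
  show "case p of (Q, B) \<Rightarrow> \<exists>f. linear_map_on_vecs (2*n) f \<and>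
      (\<exists>S\<in>Sp n. \<exists>d. (d, S *\<^sub>v B) \<in> Theta_OH n \<and> Q = williamson_mat n S d) \<and>
      (\<forall>S\<in>Sp n. \<forall>d. (d, S *\<^sub>v B) \<in> Theta_OH n \<and> Q = williamson_mat n S d \<longrightarrow>
         theta_OH n (d, S *\<^sub>v B) \<in> OH n \<and>
         system_morphism (theta_PH n (Q, B)) (theta_OH n (d, S *\<^sub>v B)) f)"
    unfolding QB prod.case using 1 2 3 S Qd by blast
qed

end
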